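(* Let $q$ be a prime power and $n\in\mathbb{N}$. If $\varphi$ is a $q$-matroid on $\mathbb{B}_n(q)$, then its poset of independent spaces $P(\varphi)=\{x\in\mathbb{B}_n(q):\varphi(x)=\dim(x)\}$ is $\mathbb{B}(q)$-positive. In particular, the chain polynomials of $P(\varphi)$ and of its rank-selected subposets $\{x\in P(\varphi):\dim(x)\in S\}$, $S\subseteq\mathbb{N}$, are real-rooted.
   Context: $\mathbb{B}_n(q)$ is the lattice of all linear subspaces of $\mathbb{F}_q^n$ ordered by inclusion. A $q$-matroid on $\mathbb{B}_n(q)$ is a function $\varphi:\mathbb{B}_n(q)\to\mathbb{N}$ such that (1) $\varphi(x)\le\dim(x)$ for all $x$; (2) $\varphi(x)\le\varphi(y)$ for all $x\le y$; (3) $\varphi(x\vee y)+\varphi(x\wedge y)\le\varphi(x)+\varphi(y)$ for all $x,y$. $P(\varphi)$ carries the order induced from $\mathbb{B}_n(q)$; it is a pure order ideal of $\mathbb{B}_n(q)$, with rank function $\dim$. $\mathbb{B}(q)$-positivity: let $\alpha:\mathbb{R}[t]\to\mathbb{R}[t]$, $\alpha(f)(t)=f(qt)$, let $t$ also denote multiplication by $t$, and put $R^q_{m,k}(t)=(t+\alpha)^{m-k}\,t^k$ for $0\le k\le m$ (so $R^q_{m,0}(t)=\sum_k\binom mk_qt^k$, $R^q_{m,m}(t)=t^m$ and $R^q_{m+1,k+1}=R^q_{m+1,k}-q^kR^q_{m,k}$). An order ideal $P$ of $\mathbb{B}_n(q)$ of rank $r$ (maximal dimension of an element) is $\mathbb{B}(q)$-positive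 if $\sum_{x\in P}t^{\dim(x)}=\sum_{k=0}^r h_kR^q_{r,k}(t)$ with all $h_k\ge0$. The chain polynomial of a finite poset $Q$ is $c_Q(t)=\sum_C t^{|C|}$, the sum over all chains $C$ in $Q$ (including the empty one). Real-rooted means all complex zeros are real (nonzero constants count as real-rooted). *)

theory Defs
  imports
    Complex_Main
    "HOL-Library.Function_Algebras"
    "HOL-Library.Cardinality"
    "HOL-Computational_Algebra.Polynomial"
begin

text \<open>
  The space \<open>F\<^sup>n\<close> over a field type \<open>'a\<close> is modelled by the functions \<open>nat \<Rightarrow> 'a\<close> that vanish
  at all indices \<open>\<ge> n\<close>, so that \<open>n\<close> may be any natural number, including 0.
\<close>

definition fscale :: "'a::field \<Rightarrow> (nat \<Rightarrow> 'a) \<Rightarrow> nat \<Rightarrow> 'a" where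
  "fscale c v = (\<lambda>i. c * v i)"

global_interpretation fs: vector_space "fscale :: 'a::field \<Rightarrow> (nat \<Rightarrow> 'a) \<Rightarrow> nat \<Rightarrow> 'a"
  by unfold_locales (auto simp: fscale_def fun_eq_iff algebra_simps)

definition coord_space :: "nat \<Rightarrow> (nat \<Rightarrow> 'a::field) set" where
  "coord_space n = {v. \<forall>i\<ge>n. v i = 0}"

definition subspaces :: "nat \<Rightarrow> (nat \<Rightarrow> 'a::field) set set" where
  "subspaces n = {x. fs.subspace x \<and> x \<subseteq> coord_space n}"

lemma finite_subspaces: "finite (subspaces n :: (nat \<Rightarrow> 'a::{field,finite}) set set)"
proof -
  have "finite (coord_space n :: (nat \<Rightarrow> 'a) set)"
    using finite_set_of_finite_funs[of "{..<n}" "UNIV :: 'a set" 0]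
    by (simp add: coord_space_def not_less)
  then show ?thesis
    by (rule finite_subset[rotated, OF finite_Pow_iff[THEN iffD2]]) (auto simp: subspaces_def)
qed

text \<open>In the lattice of subspaces the join of \<open>x\<close> and \<open>y\<close> is \<open>fs.span (x \<union> y)\<close>, the meet is \<open>x \<inter> y\<close>.\<close>

definition q_matroid :: "nat \<Rightarrow> ((nat \<Rightarrow> 'a::field) set \<Rightarrow> nat) \<Rightarrow> bool" where
  "q_matroid n \<phi> \<longleftrightarrow>
     (\<forall>x\<in>subspaces n. \<phi> x \<le> fs.dim x) \<and>
     (\<forall>x\<in>subspaces n. \<forall>y\<in>subspaces n. x \<subseteq> y \<longrightarrow> \<phi> x \<le> \<phi> y) \<and>
     (\<forall>x\<in>subspaces n. \<forall>y\<in>subspaces n. \<phi> (fs.span (x \<union> y)) + \<phi> (x \<inter> y) \<le> \<phi> x + \<phi> y)"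

definition indep_spaces :: "nat \<Rightarrow> ((nat \<Rightarrow> 'a::field) set \<Rightarrow> nat) \<Rightarrow> (nat \<Rightarrow> 'a) set set" where
  "indep_spaces n \<phi> = {x \<in> subspaces n. \<phi> x = fs.dim x}"

definition order_ideal :: "nat \<Rightarrow> (nat \<Rightarrow> 'a::field) set set \<Rightarrow> bool" where
  "order_ideal n P \<longleftrightarrow>
     P \<subseteq> subspaces n \<and> (\<forall>x\<in>P. \<forall>y\<in>subspaces n. y \<subseteq> x \<longrightarrow> y \<in> P)"

definition alpha :: "nat \<Rightarrow> real poly \<Rightarrow> real poly" where
  "alpha q f = pcompose f [:0, real q:]"

text \<open>\<open>Rpoly q m k\<close> is the operator \<open>t + \<alpha>\<close>, iterated \<open>m - k\<close> times, applied to \<open>t\<^sup>k\<close>; it is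
  only meant for \<open>k \<le> m\<close>.\<close>

definition Rpoly :: "nat \<Rightarrow> nat \<Rightarrow> nat \<Rightarrow> real poly" where
  "Rpoly q m k = ((\<lambda>f. [:0, 1:] * f + alpha q f) ^^ (m - k)) (monom 1 k)"

definition ideal_rank :: "(nat \<Rightarrow> 'a::field) set set \<Rightarrow> nat" where
  "ideal_rank P = Max (fs.dim ` P)"

text \<open>Nonemptiness is required because the rank of the empty ideal is undefined.\<close>

definition Bq_positive :: "nat \<Rightarrow> nat \<Rightarrow> (nat \<Rightarrow> 'a::field) set set \<Rightarrow> bool" where
  "Bq_positive q n P \<longleftrightarrow>
     order_ideal n P \<and> P \<noteq> {} \<and>
     (\<exists>h :: nat \<Rightarrow> real.
        (\<forall>k\<le>ideal_rank P. 0 \<le> h k) \<and>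
        (\<Sum>x\<in>P. monom 1 (fs.dim x)) = (\<Sum>k\<le>ideal_rank P. smult (h k) (Rpoly q (ideal_rank P) k)))"

text \<open>A set \<open>Q\<close> carries the order induced from its type, which for a type of sets is inclusion.\<close>

definition chain_poly :: "'b::order set \<Rightarrow> real poly" where
  "chain_poly Q = (\<Sum>C | C \<subseteq> Q \<and> Complete_Partial_Order.chain (\<le>) C. monom 1 (card C))"

definition real_rooted :: "real poly \<Rightarrow> bool" where
  "real_rooted p \<longleftrightarrow> (\<forall>z::complex. poly (map_poly complex_of_real p) z = 0 \<longrightarrow> z \<in> \<real>)"

end

theory Submission
  imports Defs
begin

text \<open>
  Positivity. For a subspace \<open>V\<close> of dimension \<open>n\<close> let \<open>f\<^sub>V\<close> be the rank generating polynomial of the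
  independent spaces inside \<open>V\<close>. If \<open>V\<close> has a hyperplane \<open>H\<close> with \<open>\<phi> H < \<phi> V\<close>, then \<open>x\<close>, not inside \<open>H\<close>, is
  independent iff \<open>x \<inter> H\<close> is, so \<open>f\<^sub>V(t) = f\<^sub>H(t) + q\<^bsup>n-1\<^esup> t f\<^sub>H(t/q)\<close>, and this operator preserves
  positivity. Otherwise all hyperplanes have the rank \<open>r < n\<close> of \<open>V\<close>, and counting the hyperplanes
  above each \<open>x\<close> gives \<open>(q - 1) \<Sum>\<^sub>H f\<^sub>H(t) = q\<^sup>n f\<^sub>V(t/q) - f\<^sub>V(t)\<close>. In the basis \<open>R\<^bsub>r,k\<^esub>\<close> the operator on
  the right is bidiagonal, with positive diagonal and nonpositive off-diagonal entries, so its
  inverse preserves positivity. Induction on \<open>n\<close> replaces a shelling.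

  Real-rootedness. Let \<open>A\<^bsub>m,k\<^esub>\<close> be the image of \<open>R\<^bsub>m,k\<^esub>\<close> under the linear map that turns rank generating
  polynomials into (rank-selected) chain polynomials. From
  \<open>R\<^bsub>m+1,k\<^esub> = t\<^bsup>m+1\<^esup> + \<Sum>\<^bsub>k\<le>i\<le>m\<^esub> q\<^sup>i R\<^bsub>m,i\<^esub>\<close> one gets
  \<open>A\<^bsub>m+1,k\<^esub> = \<epsilon> t \<Sum>\<^bsub>i\<le>m\<^esub> q\<^sup>i A\<^bsub>m,i\<^esub> + \<Sum>\<^bsub>k\<le>i\<le>m\<^esub> q\<^sup>i A\<^bsub>m,i\<^esub>\<close>, where \<open>\<epsilon> = 1\<close> if the rank \<open>m + 1\<close> is selected
  and \<open>\<epsilon> = 0\<close> otherwise. Fix \<open>z\<close> in the upper half plane and put \<open>s = z / (1 + z)\<close>. The recurrence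
  preserves the property that \<open>A\<^bsub>m,0\<^esub>(z), \<dots>, A\<^bsub>m,m\<^esub>(z), s A\<^bsub>m,0\<^esub>(z), \<dots>, s A\<^bsub>m,m\<^esub>(z)\<close> are ordered by argument.
  So the \<open>A\<^bsub>m,k\<^esub>(z)\<close> lie in an open half plane and no nonnegative combination with a positive weight
  on \<open>A\<^bsub>m,0\<^esub>\<close> vanishes at \<open>z\<close>.
\<close>

section \<open>The polynomials R\<close>

definition alpha_inv :: "nat \<Rightarrow> real poly \<Rightarrow> real poly" where
  "alpha_inv q f = pcompose f [:0, 1 / real q:]"

lemma coeff_alpha: "coeff (alpha q f) j = real q ^ j * coeff f j"
  by (simp add: alpha_def coeff_pcompose_linear)

lemma coeff_alpha_inv: "coeff (alpha_inv q f) j = coeff f j / real q ^ j"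
  by (simp add: alpha_inv_def coeff_pcompose_linear power_one_over)

lemma coeff_t_times: "coeff (pCons 0 f) j = (if j = 0 then 0 else coeff f (j - 1))"
  by (cases j) auto

definition Rop :: "nat \<Rightarrow> real poly \<Rightarrow> real poly" where
  "Rop q f = [:0, 1:] * f + alpha q f"

lemma coeff_Rop:
  "coeff (Rop q f) j = (if j = 0 then 0 else coeff f (j - 1)) + real q ^ j * coeff f j"
  by (simp add: Rop_def coeff_alpha coeff_t_times)

lemma Rop_linear:
  "Rop q (f + g) = Rop q f + Rop q g" "Rop q (f - g) = Rop q f - Rop q g"
  "Rop q (smult c f) = smult c (Rop q f)"
  by (simp_all add: Rop_def alpha_def pcompose_add pcompose_diff pcompose_smult smult_add_right)

lemma alpha_inv_sum_smult:
  "alpha_inv q (\<Sum>x\<in>A. smult (c x) (f x)) = (\<Sum>x\<in>A. smult (c x) (alpha_inv q (f x)))"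
  by (simp add: alpha_inv_def pcompose_sum pcompose_smult)

lemmas op_coeffs = coeff_Rop coeff_alpha_inv coeff_t_times

lemma Rpoly_diag: "Rpoly q m m = monom 1 m"
  by (simp add: Rpoly_def)

lemma Rpoly_Suc: "k \<le> m \<Longrightarrow> Rpoly q (Suc m) k = Rop q (Rpoly q m k)"
  by (simp add: Rpoly_def Suc_diff_le Rop_def)

text \<open>The case \<open>m = k\<close> is a direct computation. The linear operator
  \<open>Rop q\<close> raises \<open>m\<close> by one in all three terms, so it carries the identity
  upwards with \<open>k\<close> fixed.\<close>

lemma Rpoly_step:
  assumes "k \<le> m"
  shows "Rpoly q (Suc m) k = Rpoly q (Suc m) (Suc k) + smult (real q ^ k) (Rpoly q m k)"
  using assms
proof (induction m rule: dec_induct)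
  case base
  show ?case
    by (rule poly_eqI) (auto simp: Rpoly_Suc Rpoly_diag op_coeffs)
next
  case (step m)
  have "Rop q (Rpoly q (Suc m) k) =
      Rop q (Rpoly q (Suc m) (Suc k)) + smult (real q ^ k) (Rop q (Rpoly q m k))"
    by (subst step.IH) (simp only: Rop_linear)
  then show ?case
    using step.hyps by (simp add: Rpoly_Suc)
qed

text \<open>Telescopes \<open>Rpoly_step\<close> from \<open>k\<close> up to
  \<open>Rpoly q (Suc m) (Suc m)\<close>. The recurrence of \<open>chainR\<close> mirrors this
  expansion.\<close>

lemma Rpoly_Suc_eq_sum:
  assumes "k \<le> Suc m"
  shows "Rpoly q (Suc m) k = monom 1 (Suc m) + (\<Sum>i\<in>{k..m}. smult (real q ^ i) (Rpoly q m i))"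
  using assms
proof (induction k rule: inc_induct)
  case base
  show ?case by (simp add: Rpoly_diag)
next
  case (step k)
  then show ?case
    by (simp add: Rpoly_step[of k m] sum.atLeast_Suc_atMost[of k m])
qed

text \<open>For \<open>m = k\<close> the factor \<open>q^m\<close> cancels the \<open>q^k\<close>
  that \<open>alpha_inv\<close> produces. From \<open>m\<close> to \<open>m + 1\<close>, the
  operator \<open>f(t) \<mapsto> q^m t f(t/q)\<close> moves past \<open>Rop q\<close> at the price
  of one more factor \<open>q\<close>.\<close>

lemma t_alpha_inv_Rpoly:
  assumes "q > 0" "k \<le> m"
  shows "smult (real q ^ m) ([:0, 1:] * alpha_inv q (Rpoly q m k)) = Rpoly q (Suc m) (Suc k)"
  using assms(2)
proof (induction m rule: dec_induct)
  case base
  show ?case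
    using assms(1) by (intro poly_eqI) (auto simp: Rpoly_diag op_coeffs)
next
  case (step m)
  have "smult (real q ^ Suc m) ([:0, 1:] * alpha_inv q (Rop q f)) =
        Rop q (smult (real q ^ m) ([:0, 1:] * alpha_inv q f))" for f
  proof (rule poly_eqI)
    fix j
    consider "j = 0" | "j = 1" | i where "j = Suc (Suc i)"
      by (metis One_nat_def not0_implies_Suc)
    then show "coeff (smult (real q ^ Suc m) ([:0, 1:] * alpha_inv q (Rop q f))) j =
          coeff (Rop q (smult (real q ^ m) ([:0, 1:] * alpha_inv q f))) j"
      using assms(1) by cases (auto simp: op_coeffs field_simps)
  qed
  then show ?case
    using step by (simp only: Rpoly_Suc[of k m] Rpoly_Suc[of "Suc k" "Suc m"] Suc_le_mono)
qed

text \<open>\<open>alpha_inv\<close> is bidiagonal in the basis \<open>R_{m,k}\<close>. For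
  \<open>k = m\<close> the last coefficient is 0, so \<open>Rpoly q m (Suc m)\<close>, which lies
  outside the family, does not contribute.\<close>

lemma alpha_inv_Rpoly:
  assumes "q > 0" "k \<le> m"
  shows "smult (real q ^ m) (alpha_inv q (Rpoly q m k)) =
         smult (real q ^ (m - k)) (Rpoly q m k) - smult (real q ^ (m - k) - 1) (Rpoly q m (Suc k))"
  using assms(2)
proof (induction m rule: dec_induct)
  case base
  show ?case
    using assms(1) by (intro poly_eqI) (auto simp: Rpoly_diag op_coeffs)
next
  case (step m)
  define a where "a = real q ^ (m - k)"
  have a: "real q ^ (Suc m - k) = real q * a"
    using step by (simp add: a_def Suc_diff_le)
  have m: "real q ^ m = a * real q ^ k"
    using step by (simp add: a_def flip: power_add)
  \<comment> \<open>\<open>alpha_inv\<close> commutes with \<open>Rop q\<close> up to a multiple of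
    \<open>f\<close>; for \<open>f = Rpoly q m k\<close>, \<open>Rpoly_step\<close> then moves that
    multiple to level \<open>Suc m\<close>.\<close>
  have "smult (real q ^ Suc m) (alpha_inv q (Rop q f)) =
        Rop q (smult (real q ^ m) (alpha_inv q f)) + smult (real q ^ Suc m - real q ^ m) f" for f
    using assms(1)
    by (intro poly_eqI, rename_tac j, case_tac j) (auto simp: op_coeffs field_simps)
  then have "smult (real q ^ Suc m) (alpha_inv q (Rpoly q (Suc m) k)) =
        Rop q (smult (real q ^ m) (alpha_inv q (Rpoly q m k)))
        + smult (real q ^ Suc m - real q ^ m) (Rpoly q m k)"
    using step by (simp only: Rpoly_Suc[of k m])
  also have "Rop q (smult (real q ^ m) (alpha_inv q (Rpoly q m k))) =
        smult a (Rpoly q (Suc m) k) - smult (a - 1) (Rop q (Rpoly q m (Suc k)))"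
    unfolding step.IH Rop_linear using step.hyps by (simp add: a_def Rpoly_Suc)
  \<comment> \<open>For \<open>k = m\<close> the rule \<open>Rpoly_Suc\<close> does not cover
    \<open>Suc k\<close>, but then \<open>a = 1\<close> and both sides vanish.\<close>
  also have "smult (a - 1) (Rop q (Rpoly q m (Suc k))) = smult (a - 1) (Rpoly q (Suc m) (Suc k))"
    using step by (cases "k = m") (auto simp: a_def Rpoly_Suc)
  also have "smult (real q ^ Suc m - real q ^ m) (Rpoly q m k) =
      smult (real q * a - a) (Rpoly q (Suc m) k - Rpoly q (Suc m) (Suc k))"
    using Rpoly_step[of k m q] step by (simp add: m algebra_simps)
  finally show ?case
    unfolding a by (simp add: smult_diff_left smult_diff_right)
qed

text \<open>Here \<open>n\<close> is the dimension of \<open>V\<close> and \<open>r\<close> the rank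
  of the hyperplane. As \<open>r < n\<close>, both coefficients are nonnegative, so passing from
  \<open>f_H\<close> to \<open>f_V\<close> keeps positivity.\<close>

lemma Rpoly_hyperplane_extend:
  assumes "q > 0" "k \<le> r" "r < n"
  shows "Rpoly q r k + smult (real q ^ (n - 1)) ([:0, 1:] * alpha_inv q (Rpoly q r k)) =
         smult (1 / real q ^ k) (Rpoly q (Suc r) k)
         + smult (real q ^ (n - Suc r) - 1 / real q ^ k) (Rpoly q (Suc r) (Suc k))"
proof -
  have "real q ^ (n - 1) = real q ^ (n - Suc r) * real q ^ r"
    using assms by (simp flip: power_add)
  then have "smult (real q ^ (n - 1)) ([:0, 1:] * alpha_inv q (Rpoly q r k)) =
      smult (real q ^ (n - Suc r)) (Rpoly q (Suc r) (Suc k))"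
    using t_alpha_inv_Rpoly[OF assms(1,2)] by (metis smult_smult)
  moreover have "Rpoly q r k = smult (1 / real q ^ k) (Rpoly q (Suc r) k - Rpoly q (Suc r) (Suc k))"
    using Rpoly_step[OF assms(2), of q] assms(1) by simp
  ultimately show ?thesis
    by (simp add: smult_diff_right smult_diff_left)
qed

text \<open>The operator behind the sum over all hyperplanes, for \<open>V\<close> of dimension
  \<open>n\<close> and rank \<open>r\<close>. Its off-diagonal entry vanishes at
  \<open>k = r\<close>.\<close>

lemma Rpoly_hyperplane_average:
  assumes "q > 0" "k \<le> r" "r \<le> n"
  shows "smult (real q ^ n) (alpha_inv q (Rpoly q r k)) - Rpoly q r k =
         smult (real q ^ (n - k) - 1) (Rpoly q r k)
         - smult (real q ^ (n - k) - real q ^ (n - r)) (Rpoly q r (Suc k))"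
proof -
  have e: "real q ^ n = real q ^ (n - r) * real q ^ r"
    "real q ^ (n - k) = real q ^ (n - r) * real q ^ (r - k)"
    using assms by (simp_all flip: power_add)
  have "smult (real q ^ n) (alpha_inv q (Rpoly q r k)) =
     smult (real q ^ (n - r)) (smult (real q ^ r) (alpha_inv q (Rpoly q r k)))"
    by (simp add: e)
  then show ?thesis
    unfolding alpha_inv_Rpoly[OF assms(1,2)] e(2)
    by (simp add: smult_diff_right smult_diff_left smult_add_right smult_add_left)
qed

lemma coeff_0_Rpoly: "k \<le> m \<Longrightarrow> coeff (Rpoly q m k) 0 = (if k = 0 then 1 else 0)"
  by (induction m rule: dec_induct) (auto simp: Rpoly_diag Rpoly_Suc op_coeffs)

lemma coeff_Rpoly_eq_0: "k \<le> m \<Longrightarrow> m < j \<Longrightarrow> coeff (Rpoly q m k) j = 0"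
  by (induction m arbitrary: j rule: dec_induct) (auto simp: Rpoly_diag Rpoly_Suc op_coeffs)

section \<open>Subspaces of a finite coordinate space\<close>

lemma subspacesD: "V \<in> subspaces n \<Longrightarrow> fs.subspace V" "V \<in> subspaces n \<Longrightarrow> V \<subseteq> coord_space n"
  by (simp_all add: subspaces_def)

lemma subspace_coord_space: "fs.subspace (coord_space n)"
  by (auto simp: fs.subspace_def coord_space_def fscale_def)

lemma coord_space_in_subspaces: "coord_space n \<in> subspaces n"
  by (simp add: subspaces_def subspace_coord_space)

lemma zero_in_subspaces: "{0} \<in> subspaces n"
  using fs.subspace_0[OF subspace_coord_space] by (auto simp: subspaces_def fs.subspace_single_0)

lemma subspaces_mono: "V \<in> subspaces n \<Longrightarrow> fs.subspace x \<Longrightarrow> x \<subseteq> V \<Longrightarrow> x \<in> subspaces n"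
  by (auto simp: subspaces_def)

lemma Int_in_subspaces: "x \<in> subspaces n \<Longrightarrow> y \<in> subspaces n \<Longrightarrow> x \<inter> y \<in> subspaces n"
  by (auto simp: subspaces_def fs.subspace_inter)

lemma finite_coord_space: "finite (coord_space n :: (nat \<Rightarrow> 'a::{field,finite}) set)"
  using finite_set_of_finite_funs[of "{..<n}" "UNIV :: 'a set" 0]
  by (simp add: coord_space_def not_less)

lemma finite_subspace: "(V :: (nat \<Rightarrow> 'a::{field,finite}) set) \<in> subspaces n \<Longrightarrow> finite V"
  using finite_subset[OF subspacesD(2) finite_coord_space] .

lemma card_field_gt_1: "CARD('a::{field,finite}) > 1"
proof -
  have "card {0, 1 :: 'a} \<le> CARD('a)"
    by (rule card_mono) auto
  then show ?thesis by simp
qed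

lemma card_span_insert:
  fixes A :: "(nat \<Rightarrow> 'a::{field,finite}) set"
  assumes "v \<notin> fs.span A"
  shows "card (fs.span (insert v A)) = CARD('a) * card (fs.span A)"
proof -
  define f where "f = (\<lambda>(c, u). fscale c v + u)"
  have "fs.span (insert v A) = f ` (UNIV \<times> fs.span A)"
  proof (intro equalityI subsetI)
    fix x assume "x \<in> fs.span (insert v A)"
    then obtain k where "x - fscale k v \<in> fs.span A"
      by (auto simp: fs.span_insert)
    then show "x \<in> f ` (UNIV \<times> fs.span A)"
      by (intro image_eqI[of _ _ "(k, x - fscale k v)"]) (auto simp: f_def)
  next
    fix x assume "x \<in> f ` (UNIV \<times> fs.span A)"
    then obtain c u where "x = fscale c v + u" "u \<in> fs.span A"
      by (auto simp: f_def)
    then have "x - fscale c v \<in> fs.span A" by simp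
    then show "x \<in> fs.span (insert v A)"
      by (auto simp: fs.span_insert)
  qed
  moreover have "inj_on f (UNIV \<times> fs.span A)"
  proof (rule inj_onI, clarify)
    fix c c' u u'
    assume u: "u \<in> fs.span A" "u' \<in> fs.span A" and eq: "f (c, u) = f (c', u')"
    then have diff: "fscale (c - c') v = u' - u"
      by (simp add: f_def fs.scale_left_diff_distrib algebra_simps)
    have "c = c'"
    proof (rule ccontr)
      assume "c \<noteq> c'"
      then have "v = fscale (1 / (c - c')) (u' - u)"
        by (simp flip: diff)
      also have "\<dots> \<in> fs.span A"
        using u by (intro fs.span_scale fs.span_diff)
      finally show False using assms by blast
    qed
    then show "c = c' \<and> u = u'"
      using eq by (simp add: f_def)
  qed
  ultimately show ?thesis
    by (simp add: card_image card_cartesian_product)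
qed

text \<open>As the field has more than one element, this reduces the next comparisons and
  computations of dimensions to cardinalities.\<close>

lemma card_subspace:
  fixes V :: "(nat \<Rightarrow> 'a::{field,finite}) set"
  assumes "V \<in> subspaces n"
  shows "card V = CARD('a) ^ fs.dim V"
proof -
  obtain B where B: "B \<subseteq> V" "fs.independent B" "V \<subseteq> fs.span B" "card B = fs.dim V"
    using fs.basis_exists[of V] by auto
  have "finite B"
    using B(1) finite_subspace[OF assms] finite_subset by blast
  then have "fs.independent B \<Longrightarrow> card (fs.span B) = CARD('a) ^ card B"
  proof (induction B rule: finite_induct)
    case (insert b B)
    then show ?case
      by (simp add: card_span_insert fs.independent_insert)
  qed simp
  moreover have "fs.span B = V"
    using B fs.span_minimal[OF B(1) subspacesD(1)[OF assms]] by blast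
  ultimately show ?thesis
    using B by simp
qed

lemma dim_mono_subspaces:
  fixes x y :: "(nat \<Rightarrow> 'a::{field,finite}) set"
  assumes "x \<in> subspaces n" "y \<in> subspaces n" "x \<subseteq> y"
  shows "fs.dim x \<le> fs.dim y"
  using card_mono[OF finite_subspace[OF assms(2)] assms(3)] card_field_gt_1[where 'a='a]
  by (simp add: card_subspace[OF assms(1)] card_subspace[OF assms(2)])

lemma dim_strict_mono_subspaces:
  fixes x y :: "(nat \<Rightarrow> 'a::{field,finite}) set"
  assumes "x \<in> subspaces n" "y \<in> subspaces n" "x \<subset> y"
  shows "fs.dim x < fs.dim y"
  using psubset_card_mono[OF finite_subspace[OF assms(2)] assms(3)] card_field_gt_1[where 'a='a]
  by (simp add: card_subspace[OF assms(1)] card_subspace[OF assms(2)])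

lemma subspace_eq_if_dim_le:
  fixes x y :: "(nat \<Rightarrow> 'a::{field,finite}) set"
  assumes "x \<in> subspaces n" "y \<in> subspaces n" "x \<subseteq> y" "fs.dim y \<le> fs.dim x"
  shows "x = y"
  using dim_strict_mono_subspaces[OF assms(1,2)] assms(3,4) by fastforce

lemma span_insert_subspace:
  assumes "V \<in> subspaces n" "x \<in> subspaces n" "x \<subseteq> V" "v \<in> V"
  shows "fs.span (insert v x) \<in> subspaces n" "fs.span (insert v x) \<subseteq> V"
    "x \<subseteq> fs.span (insert v x)" "v \<in> fs.span (insert v x)"
proof -
  show "fs.span (insert v x) \<subseteq> V"
    using assms by (intro fs.span_minimal subspacesD) auto
  then show "fs.span (insert v x) \<in> subspaces n"
    using assms subspaces_mono by blast
qed (auto intro: fs.span_base)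

lemma dim_span_insert:
  fixes x :: "(nat \<Rightarrow> 'a::{field,finite}) set"
  assumes "V \<in> subspaces n" "x \<in> subspaces n" "x \<subseteq> V" "v \<in> V" "v \<notin> x"
  shows "fs.dim (fs.span (insert v x)) = Suc (fs.dim x)"
proof -
  have "fs.span x = x"
    using assms subspacesD by (simp add: fs.span_eq_iff)
  then have "card (fs.span (insert v x)) = CARD('a) * card x"
    using assms(5) card_span_insert[of v x] by metis
  then have "CARD('a) ^ fs.dim (fs.span (insert v x)) = CARD('a) ^ Suc (fs.dim x)"
    using card_subspace[OF span_insert_subspace(1)[OF assms(1-4)]] card_subspace[OF assms(2)]
    by simp
  then show ?thesis
    using card_field_gt_1[where 'a='a] power_inject_exp by blast
qed

section \<open>Hyperplanes: existence, sections and counts\<close>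

definition hyperplane :: "nat \<Rightarrow> (nat \<Rightarrow> 'a::field) set \<Rightarrow> (nat \<Rightarrow> 'a) set \<Rightarrow> bool" where
  "hyperplane n V H \<longleftrightarrow> H \<in> subspaces n \<and> H \<subseteq> V \<and> fs.dim V = Suc (fs.dim H)"

lemma hyperplane_psubset: "hyperplane n V H \<Longrightarrow> H \<subset> V"
  by (auto simp: hyperplane_def)

text \<open>Vectors of \<open>V\<close> are adjoined to \<open>x\<close> one at a time; the last
  proper subspace before \<open>V\<close> has codimension one.\<close>

lemma hyperplane_exists:
  fixes V :: "(nat \<Rightarrow> 'a::{field,finite}) set"
  assumes V: "V \<in> subspaces n" and x: "x \<in> subspaces n" "x \<subset> V"
  shows "\<exists>H. hyperplane n V H \<and> x \<subseteq> H"
  using x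
proof (induction "fs.dim V - fs.dim x" arbitrary: x rule: less_induct)
  case less
  then obtain v where v: "v \<in> V" "v \<notin> x" by blast
  let ?y = "fs.span (insert v x)"
  have y: "?y \<in> subspaces n" "?y \<subseteq> V" "x \<subseteq> ?y" "fs.dim ?y = Suc (fs.dim x)"
    using span_insert_subspace[OF V less(2) _ v(1)] dim_span_insert[OF V less(2) _ v] less(3) by auto
  show ?case
  proof (cases "?y = V")
    case True
    then show ?thesis
      using y less by (auto simp: hyperplane_def)
  next
    case False
    then have "?y \<subset> V" using y by blast
    moreover have "fs.dim V - fs.dim ?y < fs.dim V - fs.dim x"
      using y(4) dim_strict_mono_subspaces[OF less(2) V less(3)] by linarith
    ultimately show ?thesis
      using less(1)[OF _ y(1)] y(3) by blast
  qed
qed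

lemma span_hyperplane:
  fixes V :: "(nat \<Rightarrow> 'a::{field,finite}) set"
  assumes V: "V \<in> subspaces n" and H: "hyperplane n V H" and v: "v \<in> V" "v \<notin> H"
  shows "fs.span (insert v H) = V"
  using span_insert_subspace[OF V _ _ v(1)] dim_span_insert[OF V _ _ v] H
  by (intro subspace_eq_if_dim_le[OF _ V]) (auto simp: hyperplane_def)

text \<open>\<open>V\<close> is spanned by \<open>v\<close> and \<open>H\<close>, so each
  \<open>u\<close> in \<open>x\<close> falls into \<open>H\<close> after subtracting a multiple of
  \<open>v\<close>, and the difference stays in \<open>x\<close>.\<close>

lemma hyperplane_section:
  fixes V :: "(nat \<Rightarrow> 'a::{field,finite}) set"
  assumes V: "V \<in> subspaces n" and H: "hyperplane n V H"
    and x: "x \<in> subspaces n" "x \<subseteq> V" "v \<in> x" "v \<notin> H"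
  shows "x = fs.span (insert v (x \<inter> H))" "fs.dim x = Suc (fs.dim (x \<inter> H))"
proof -
  have sub: "x \<inter> H \<in> subspaces n"
    using H x by (auto simp: hyperplane_def intro: Int_in_subspaces)
  show eq: "x = fs.span (insert v (x \<inter> H))"
  proof
    show "fs.span (insert v (x \<inter> H)) \<subseteq> x"
      using span_insert_subspace(2)[OF x(1) sub _ x(3)] by blast
    show "x \<subseteq> fs.span (insert v (x \<inter> H))"
    proof
      fix u assume u: "u \<in> x"
      then have "u \<in> fs.span (insert v H)"
        using span_hyperplane[OF V H] x by blast
      then obtain c where "u - fscale c v \<in> fs.span H"
        by (auto simp: fs.span_insert)
      then have "u - fscale c v \<in> H"
        using H by (metis fs.span_eq_iff hyperplane_def subspacesD(1))
      moreover have "u - fscale c v \<in> x"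
        using u x subspacesD(1)[OF x(1)] by (intro fs.subspace_diff fs.subspace_scale) auto
      ultimately show "u \<in> fs.span (insert v (x \<inter> H))"
        by (auto simp: fs.span_insert intro: fs.span_base)
    qed
  qed
  show "fs.dim x = Suc (fs.dim (x \<inter> H))"
    using dim_span_insert[OF x(1) sub _ x(3)] x(4) eq by auto
qed

lemma span_insert_Int_hyperplane:
  fixes V :: "(nat \<Rightarrow> 'a::{field,finite}) set"
  assumes V: "V \<in> subspaces n" and H: "hyperplane n V H"
    and z: "z \<in> subspaces n" "z \<subseteq> H" and v: "v \<in> V" "v \<notin> H"
  shows "fs.span (insert v z) \<inter> H = z"
proof -
  have zV: "z \<subseteq> V"
    using z H by (auto simp: hyperplane_def)
  note s = span_insert_subspace[OF V z(1) zV v(1)]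
  have "z = fs.span (insert v z) \<inter> H"
  proof (rule subspace_eq_if_dim_le[OF z(1)])
    show "fs.span (insert v z) \<inter> H \<in> subspaces n"
      using s H by (auto simp: hyperplane_def intro: Int_in_subspaces)
    show "fs.dim (fs.span (insert v z) \<inter> H) \<le> fs.dim z"
    proof -
      have "v \<notin> z" using v z by blast
      from dim_span_insert[OF V z(1) zV v(1) this] hyperplane_section(2)[OF V H s(1,2,4) v(2)]
      show ?thesis by linarith
    qed
  qed (use s z in auto)
  then show ?thesis by simp
qed

text \<open>The sets \<open>x - z\<close> partition \<open>V - H\<close>, because a vector outside
  \<open>H\<close> determines \<open>x\<close> together with \<open>z\<close>. Each has
  \<open>q^(dim z) (q - 1)\<close> elements, while \<open>V - H\<close> has
  \<open>q^(dim H) (q - 1)\<close>.\<close>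

lemma card_with_hyperplane_section:
  fixes V :: "(nat \<Rightarrow> 'a::{field,finite}) set"
  assumes V: "V \<in> subspaces n" and H: "hyperplane n V H"
    and z: "z \<in> subspaces n" "z \<subseteq> H"
  shows "card {x \<in> subspaces n. x \<subseteq> V \<and> \<not> x \<subseteq> H \<and> x \<inter> H = z} = CARD('a) ^ (fs.dim H - fs.dim z)"
    (is "card ?X = _")
proof -
  let ?q = "CARD('a)"
  have Hs: "H \<in> subspaces n" "H \<subseteq> V" "fs.dim V = Suc (fs.dim H)"
    using H by (auto simp: hyperplane_def)
  have part: "(\<Union>x\<in>?X. x - z) = V - H"
  proof (intro equalityI subsetI)
    fix v assume "v \<in> V - H"
    then have v: "v \<in> V" "v \<notin> H" by auto
    have zV: "z \<subseteq> V" using z Hs by blast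
    have "fs.span (insert v z) \<in> ?X"
      using span_insert_subspace[OF V z(1) zV v(1)] span_insert_Int_hyperplane[OF V H z v] v
      by auto
    moreover have "v \<in> fs.span (insert v z) - z"
      using v z by (auto intro: fs.span_base)
    ultimately show "v \<in> (\<Union>x\<in>?X. x - z)" by blast
  qed auto
  have cx: "card (x - z) = ?q ^ fs.dim z * (?q - 1)" if x: "x \<in> ?X" for x
  proof -
    obtain v where "v \<in> x" "v \<notin> H" using x by blast
    then have "fs.dim x = Suc (fs.dim z)"
      using hyperplane_section(2)[OF V H, of x v] x by auto
    then show ?thesis
      using x z finite_subspace[OF z(1)]
      by (subst card_Diff_subset) (auto simp: card_subspace[of _ n] algebra_simps diff_mult_distrib2)
  qed
  have "?q ^ fs.dim H * (?q - 1) = card (V - H)"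
    using finite_subspace[OF Hs(1)] Hs
    by (subst card_Diff_subset) (auto simp: card_subspace[of _ n] V algebra_simps diff_mult_distrib2)
  also have "\<dots> = (\<Sum>x\<in>?X. card (x - z))"
  proof (unfold part[symmetric], rule card_UN_disjoint)
    show "finite ?X" by (rule finite_subset[OF _ finite_subspaces]) auto
    show "\<forall>x\<in>?X. finite (x - z)" by (auto intro: finite_subspace)
    show "\<forall>x\<in>?X. \<forall>y\<in>?X. x \<noteq> y \<longrightarrow> (x - z) \<inter> (y - z) = {}"
    proof (intro ballI impI, rule ccontr)
      fix x y assume xy: "x \<in> ?X" "y \<in> ?X" "x \<noteq> y" "(x - z) \<inter> (y - z) \<noteq> {}"
      then obtain v where v: "v \<in> x" "v \<in> y" "v \<notin> z" by blast
      then have "v \<notin> H" using xy by blast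
      then show False
        using xy v hyperplane_section(1)[OF V H, of x v] hyperplane_section(1)[OF V H, of y v] by auto
    qed
  qed
  also have "\<dots> = card ?X * (?q ^ fs.dim z * (?q - 1))"
    using cx by simp
  finally have "?q ^ fs.dim H = card ?X * ?q ^ fs.dim z"
    using card_field_gt_1[where 'a='a] by simp
  moreover have "?q ^ fs.dim H = ?q ^ (fs.dim H - fs.dim z) * ?q ^ fs.dim z"
    using dim_mono_subspaces[OF z(1) Hs(1) z(2)] by (simp flip: power_add)
  ultimately show ?thesis by simp
qed

text \<open>Fix a hyperplane \<open>H0\<close> above \<open>x\<close>. Any other \<open>H\<close>
  meets \<open>H0\<close> in a hyperplane \<open>K\<close> of \<open>H0\<close> above
  \<open>x\<close>, and each \<open>K\<close> arises from exactly \<open>q\<close> such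
  \<open>H\<close>. So the count for \<open>V\<close> is one plus \<open>q\<close> times the count
  for \<open>H0\<close>.\<close>

lemma card_hyperplanes_over:
  fixes V :: "(nat \<Rightarrow> 'a::{field,finite}) set"
  assumes "V \<in> subspaces n" "x \<in> subspaces n" "x \<subseteq> V"
  shows "(real CARD('a) - 1) * real (card {H. hyperplane n V H \<and> x \<subseteq> H}) =
         real CARD('a) ^ (fs.dim V - fs.dim x) - 1"
  using assms
proof (induction "fs.dim V" arbitrary: V rule: less_induct)
  case (less V)
  note V = \<open>V \<in> subspaces n\<close>
  show ?case
  proof (cases "x = V")
    case True
    then have "{H. hyperplane n V H \<and> x \<subseteq> H} = {}"
      by (auto simp: hyperplane_def)
    then show ?thesis using True by (simp only: card.empty) simp
  next
    case False
    then obtain H0 where H0: "hyperplane n V H0" "x \<subseteq> H0"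
      using hyperplane_exists[of V n x] less by blast
    then have H0s: "H0 \<in> subspaces n" "H0 \<subseteq> V" "fs.dim V = Suc (fs.dim H0)"
      by (auto simp: hyperplane_def)
    let ?K = "{K. hyperplane n H0 K \<and> x \<subseteq> K}"
    let ?X = "\<lambda>K. {H \<in> subspaces n. H \<subseteq> V \<and> \<not> H \<subseteq> H0 \<and> H \<inter> H0 = K}"
    have fin: "finite {H. hyperplane n W H \<and> x \<subseteq> H}" for W
      by (rule finite_subset[OF _ finite_subspaces[of n]]) (auto simp: hyperplane_def)
    have "{H. hyperplane n V H \<and> x \<subseteq> H} - {H0} = (\<Union>K\<in>?K. ?X K)"
    proof (intro equalityI subsetI)
      fix H assume "H \<in> {H. hyperplane n V H \<and> x \<subseteq> H} - {H0}"
      then have H: "H \<in> subspaces n" "H \<subseteq> V" "fs.dim V = Suc (fs.dim H)" "x \<subseteq> H" "H \<noteq> H0"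
        by (auto simp: hyperplane_def)
      then have "\<not> H \<subseteq> H0"
        using subspace_eq_if_dim_le[OF H(1) H0s(1)] H0s by auto
      then obtain v where "v \<in> H" "v \<notin> H0" by blast
      then have "fs.dim H = Suc (fs.dim (H \<inter> H0))"
        using hyperplane_section(2)[OF V H0(1) H(1,2)] by blast
      then have "hyperplane n H0 (H \<inter> H0)"
        using H H0s by (auto simp: hyperplane_def intro: Int_in_subspaces)
      then show "H \<in> (\<Union>K\<in>?K. ?X K)"
        using H H0 \<open>\<not> H \<subseteq> H0\<close> by blast
    next
      fix H assume "H \<in> (\<Union>K\<in>?K. ?X K)"
      then obtain v where H: "H \<in> subspaces n" "H \<subseteq> V" "v \<in> H" "v \<notin> H0"
        "hyperplane n H0 (H \<inter> H0)" "x \<subseteq> H"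
        by blast
      then have "hyperplane n V H"
        using hyperplane_section(2)[OF V H0(1) H(1-4)] H0s by (auto simp: hyperplane_def)
      then show "H \<in> {H. hyperplane n V H \<and> x \<subseteq> H} - {H0}"
        using H by auto
    qed
    moreover have "finite (?X K)" for K
      by (rule finite_subset[OF _ finite_subspaces]) auto
    then have "card (\<Union>K\<in>?K. ?X K) = (\<Sum>K\<in>?K. card (?X K))"
      by (intro card_UN_disjoint fin) auto
    moreover have "card (?X K) = CARD('a)" if "K \<in> ?K" for K
      using that card_with_hyperplane_section[OF V H0(1), of K] by (auto simp: hyperplane_def)
    ultimately have "card ({H. hyperplane n V H \<and> x \<subseteq> H} - {H0}) = card ?K * CARD('a)"
      by simp
    moreover have "H0 \<in> {H. hyperplane n V H \<and> x \<subseteq> H}"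
      using H0 by simp
    ultimately have "card {H. hyperplane n V H \<and> x \<subseteq> H} = Suc (card ?K * CARD('a))"
      by (metis card.remove fin)
    moreover have "(real CARD('a) - 1) * real (card ?K) = real CARD('a) ^ (fs.dim H0 - fs.dim x) - 1"
      using less(1)[of H0] less.prems H0s H0 by simp
    moreover have "fs.dim V - fs.dim x = Suc (fs.dim H0 - fs.dim x)"
      using dim_mono_subspaces[OF less.prems(2) H0s(1) H0(2)] H0s by simp
    ultimately show ?thesis
      by (simp add: algebra_simps)
  qed
qed

section \<open>Positivity of the independent spaces of a q-matroid\<close>

lemma q_matroidD:
  assumes "q_matroid n \<phi>" "x \<in> subspaces n"
  shows "\<phi> x \<le> fs.dim x"
    and "y \<in> subspaces n \<Longrightarrow> x \<subseteq> y \<Longrightarrow> \<phi> x \<le> \<phi> y"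
    and "y \<in> subspaces n \<Longrightarrow> \<phi> (fs.span (x \<union> y)) + \<phi> (x \<inter> y) \<le> \<phi> x + \<phi> y"
  using assms by (auto simp: q_matroid_def)

lemma dim_zero_space: "fs.dim {0 :: nat \<Rightarrow> 'a::field} = 0"
  using fs.dim_eq_card[of "{}" "{0 :: nat \<Rightarrow> 'a}"] fs.independent_empty by simp

lemma subspace_dim_0:
  fixes V :: "(nat \<Rightarrow> 'a::{field,finite}) set"
  assumes "V \<in> subspaces n" "fs.dim V = 0"
  shows "V = {0}"
  using subspace_eq_if_dim_le[OF zero_in_subspaces assms(1)] assms fs.subspace_0[OF subspacesD(1)]
  by (auto simp: dim_zero_space)

lemma zero_subset_subspace: "V \<in> subspaces n \<Longrightarrow> {0} \<subseteq> V"
  using fs.subspace_0 subspacesD(1) by blast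

text \<open>Submodularity for \<open>H\<close> and the line through a vector \<open>v\<close>
  outside \<open>H\<close>: their join is \<open>V\<close>, and the line has rank at most 1.\<close>

lemma q_matroid_hyperplane_le:
  fixes V :: "(nat \<Rightarrow> 'a::{field,finite}) set"
  assumes \<phi>: "q_matroid n \<phi>" and V: "V \<in> subspaces n" and H: "hyperplane n V H"
  shows "\<phi> V \<le> Suc (\<phi> H)"
proof -
  have Hs: "H \<in> subspaces n" "H \<subseteq> V" "fs.dim V = Suc (fs.dim H)"
    using H by (auto simp: hyperplane_def)
  obtain v where v: "v \<in> V" "v \<notin> H"
    using hyperplane_psubset[OF H] by blast
  have v0: "v \<notin> {0}"
    using v zero_subset_subspace[OF Hs(1)] by auto
  let ?l = "fs.span (insert v {0})"
  note l = span_insert_subspace[OF V zero_in_subspaces zero_subset_subspace[OF V] v(1)]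
  have "fs.span (H \<union> ?l) = V"
  proof
    show "fs.span (H \<union> ?l) \<subseteq> V"
      using Hs l by (intro fs.span_minimal subspacesD(1)[OF V]) auto
    show "V \<subseteq> fs.span (H \<union> ?l)"
      using fs.span_mono[of "insert v H" "H \<union> ?l"] span_hyperplane[OF V H v] l(4) by auto
  qed
  then have "\<phi> V + \<phi> (H \<inter> ?l) \<le> \<phi> H + \<phi> ?l"
    using q_matroidD(3)[OF \<phi> Hs(1) l(1)] by simp
  moreover have "\<phi> ?l \<le> 1"
    using q_matroidD(1)[OF \<phi> l(1)]
      dim_span_insert[OF V zero_in_subspaces zero_subset_subspace[OF V] v(1) v0]
    by (simp only: dim_zero_space)
  ultimately show ?thesis by simp
qed

text \<open>The nullity \<open>dim - \<phi>\<close> is monotone, since each step up from a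
  hyperplane raises \<open>\<phi>\<close> by at most one. Hence nullity zero passes to
  subspaces.\<close>

lemma q_matroid_nullity_mono:
  fixes V :: "(nat \<Rightarrow> 'a::{field,finite}) set"
  assumes \<phi>: "q_matroid n \<phi>" and x: "x \<in> subspaces n" and V: "V \<in> subspaces n" "x \<subseteq> V"
  shows "\<phi> V + fs.dim x \<le> \<phi> x + fs.dim V"
  using V
proof (induction "fs.dim V" arbitrary: V rule: less_induct)
  case (less V)
  show ?case
  proof (cases "x = V")
    case False
    then obtain H where H: "hyperplane n V H" "x \<subseteq> H"
      using hyperplane_exists[of V n x] x less.prems by blast
    then show ?thesis
      using less.hyps[of H] q_matroid_hyperplane_le[OF \<phi> less.prems(1) H(1)]
      by (auto simp: hyperplane_def)
  qed simp
qed

lemma indep_subspace: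
  fixes x :: "(nat \<Rightarrow> 'a::{field,finite}) set"
  assumes "q_matroid n \<phi>" "x \<in> indep_spaces n \<phi>" "y \<in> subspaces n" "y \<subseteq> x"
  shows "y \<in> indep_spaces n \<phi>"
  using q_matroid_nullity_mono[OF assms(1,3) _ assms(4)] q_matroidD(1)[OF assms(1,3)] assms
  by (auto simp: indep_spaces_def)

lemma zero_indep:
  assumes "q_matroid n \<phi>"
  shows "{0} \<in> indep_spaces n \<phi>"
  using q_matroidD(1)[OF assms zero_in_subspaces] zero_in_subspaces
  by (auto simp: indep_spaces_def dim_zero_space)

text \<open>The join of \<open>x\<close> and \<open>H\<close> is \<open>V\<close>, so submodularity
  and the rank jump from \<open>H\<close> to \<open>V\<close> give
  \<open>\<phi> x \<ge> \<phi> (x \<inter> H) + 1\<close>, which is \<open>dim x\<close> if the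
  section is independent.\<close>

lemma indep_iff_hyperplane_section:
  fixes V :: "(nat \<Rightarrow> 'a::{field,finite}) set"
  assumes \<phi>: "q_matroid n \<phi>" and V: "V \<in> subspaces n" and H: "hyperplane n V H" "\<phi> V = Suc (\<phi> H)"
    and x: "x \<in> subspaces n" "x \<subseteq> V" "\<not> x \<subseteq> H"
  shows "x \<in> indep_spaces n \<phi> \<longleftrightarrow> x \<inter> H \<in> indep_spaces n \<phi>"
proof
  have Hs: "H \<in> subspaces n" "H \<subseteq> V"
    using H by (auto simp: hyperplane_def)
  have xH: "x \<inter> H \<in> subspaces n"
    using Hs x by (auto intro: Int_in_subspaces)
  show "x \<inter> H \<in> indep_spaces n \<phi>" if "x \<in> indep_spaces n \<phi>"
    using indep_subspace[OF \<phi> that xH] by simp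
  assume "x \<inter> H \<in> indep_spaces n \<phi>"
  obtain v where v: "v \<in> x" "v \<notin> H"
    using x by blast
  have "fs.span (x \<union> H) = V"
  proof
    show "fs.span (x \<union> H) \<subseteq> V"
      using Hs x by (intro fs.span_minimal subspacesD(1)[OF V]) auto
    show "V \<subseteq> fs.span (x \<union> H)"
      using fs.span_mono[of "insert v H" "x \<union> H"] span_hyperplane[OF V H(1), of v] v x by auto
  qed
  then have "\<phi> V + \<phi> (x \<inter> H) \<le> \<phi> x + \<phi> H"
    using q_matroidD(3)[OF \<phi> x(1) Hs(1)] by simp
  then have "fs.dim x \<le> \<phi> x"
    using \<open>x \<inter> H \<in> indep_spaces n \<phi>\<close> hyperplane_section(2)[OF V H(1) x(1,2) v] H(2)
    by (simp add: indep_spaces_def)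
  then show "x \<in> indep_spaces n \<phi>"
    using q_matroidD(1)[OF \<phi> x(1)] x by (simp add: indep_spaces_def)
qed

section \<open>Rank generating polynomials and positivity by induction over hyperplanes\<close>

definition dim_poly :: "(nat \<Rightarrow> 'a::field) set set \<Rightarrow> (nat \<Rightarrow> 'a) set \<Rightarrow> real poly" where
  "dim_poly P V = (\<Sum>x | x \<in> P \<and> x \<subseteq> V. monom 1 (fs.dim x))"

lemma smult_sum_right: "smult c (sum f A) = (\<Sum>x\<in>A. smult c (f x))"
  by (induction A rule: infinite_finite_induct) (auto simp: smult_add_right)

lemma finite_subfamily:
  "P \<subseteq> subspaces n \<Longrightarrow> finite {x :: (nat \<Rightarrow> 'a::{field,finite}) set. x \<in> P \<and> Q x}"
  by (rule finite_subset[OF _ finite_subspaces]) auto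

lemma indep_spaces_subset: "indep_spaces n \<phi> \<subseteq> subspaces n"
  by (auto simp: indep_spaces_def)

lemma alpha_inv_monom: "alpha_inv q (monom 1 j) = monom (1 / real q ^ j) j"
  by (rule poly_eqI) (simp add: coeff_alpha_inv)

lemma alpha_inv_sum: "alpha_inv q (sum f A) = (\<Sum>x\<in>A. alpha_inv q (f x))"
  by (simp add: alpha_inv_def pcompose_sum)

text \<open>The members not inside \<open>H\<close> are grouped by their section \<open>z\<close>
  with \<open>H\<close>. Each \<open>z\<close> in \<open>P\<close> accounts for
  \<open>q^(dim H - dim z)\<close> spaces of dimension \<open>dim z + 1\<close>.\<close>

lemma dim_poly_hyperplane_extend:
  fixes V :: "(nat \<Rightarrow> 'a::{field,finite}) set"
  assumes P: "P \<subseteq> subspaces n" and V: "V \<in> subspaces n" and H: "hyperplane n V H"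
    and P_iff: "\<And>x. x \<in> subspaces n \<Longrightarrow> x \<subseteq> V \<Longrightarrow> \<not> x \<subseteq> H \<Longrightarrow> x \<in> P \<longleftrightarrow> x \<inter> H \<in> P"
  shows "dim_poly P V = dim_poly P H
    + smult (real CARD('a) ^ fs.dim H) ([:0, 1:] * alpha_inv CARD('a) (dim_poly P H))"
proof -
  let ?q = "CARD('a)"
  let ?I = "\<lambda>V. {x. x \<in> P \<and> x \<subseteq> V}"
  let ?X = "\<lambda>z. {x \<in> subspaces n. x \<subseteq> V \<and> \<not> x \<subseteq> H \<and> x \<inter> H = z}"
  let ?m = "\<lambda>x. monom (1 :: real) (fs.dim x)"
  have Hs: "H \<in> subspaces n" "H \<subseteq> V"
    using H by (auto simp: hyperplane_def)
  have I: "z \<in> subspaces n" if "z \<in> ?I H" for z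
    using that P by auto
  have "?I V = ?I H \<union> (\<Union>z\<in>?I H. ?X z)"
  proof (rule set_eqI)
    fix x
    show "x \<in> ?I V \<longleftrightarrow> x \<in> ?I H \<union> (\<Union>z\<in>?I H. ?X z)"
      by (cases "x \<subseteq> H") (use Hs P P_iff[of x] in auto)
  qed
  moreover have finX: "finite (?X z)" for z
    by (rule finite_subset[OF _ finite_subspaces]) auto
  ultimately have "sum ?m (?I V) = sum ?m (?I H) + sum ?m (\<Union>z\<in>?I H. ?X z)"
    by (simp only:) (rule sum.union_disjoint; auto simp: finite_subfamily[OF P])
  also have "sum ?m (\<Union>z\<in>?I H. ?X z) = (\<Sum>z\<in>?I H. sum ?m (?X z))"
    using finX by (intro sum.UNION_disjoint finite_subfamily[OF P]) auto
  also have "\<dots> = (\<Sum>z\<in>?I H. smult (real ?q ^ fs.dim H) ([:0, 1:] * alpha_inv ?q (?m z)))"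
  proof (rule sum.cong[OF refl])
    fix z assume z: "z \<in> ?I H"
    have "?m x = monom 1 (Suc (fs.dim z))" if x: "x \<in> ?X z" for x
    proof -
      obtain v where "v \<in> x" "v \<notin> H" using x by blast
      then show ?thesis
        using hyperplane_section(2)[OF V H, of x v] x by auto
    qed
    then have "sum ?m (?X z) = of_nat (card (?X z)) * monom 1 (Suc (fs.dim z))"
      by simp
    also have "card (?X z) = ?q ^ (fs.dim H - fs.dim z)"
      using card_with_hyperplane_section[OF V H I[OF z]] z by simp
    also have "real (?q ^ (fs.dim H - fs.dim z)) = real ?q ^ fs.dim H / real ?q ^ fs.dim z"
      unfolding of_nat_power using dim_mono_subspaces[OF I[OF z] Hs(1)] z by (simp add: power_diff)
    then have "of_nat (?q ^ (fs.dim H - fs.dim z)) * monom 1 (Suc (fs.dim z)) =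
        smult (real ?q ^ fs.dim H) ([:0, 1:] * alpha_inv ?q (?m z))"
      by (simp add: alpha_inv_monom of_nat_poly smult_monom monom_Suc)
    finally show "sum ?m (?X z) = smult (real ?q ^ fs.dim H) ([:0, 1:] * alpha_inv ?q (?m z))" .
  qed
  also have "\<dots> = smult (real ?q ^ fs.dim H) ([:0, 1:] * alpha_inv ?q (sum ?m (?I H)))"
    by (simp only: alpha_inv_sum sum_distrib_left smult_sum_right)
  finally show ?thesis
    by (simp add: dim_poly_def)
qed

text \<open>Double counting of the pairs \<open>x \<subseteq> H\<close>: by
  \<open>card_hyperplanes_over\<close> each \<open>x\<close> is counted
  \<open>(q^(dim V - dim x) - 1) / (q - 1)\<close> times, and \<open>alpha_inv\<close> supplies the
  factor \<open>q^(- dim x)\<close>.\<close>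

lemma dim_poly_hyperplane_average:
  fixes V :: "(nat \<Rightarrow> 'a::{field,finite}) set"
  assumes P: "P \<subseteq> subspaces n" and V: "V \<in> subspaces n"
  shows "smult (real CARD('a) - 1) (\<Sum>H | hyperplane n V H. dim_poly P H) =
    smult (real CARD('a) ^ fs.dim V) (alpha_inv CARD('a) (dim_poly P V)) - dim_poly P V"
proof -
  let ?q = "CARD('a)"
  let ?I = "\<lambda>V. {x. x \<in> P \<and> x \<subseteq> V}"
  let ?m = "\<lambda>x. monom (1 :: real) (fs.dim x)"
  have fin: "finite {H. hyperplane n V H}"
    by (rule finite_subset[OF _ finite_subspaces[of n]]) (auto simp: hyperplane_def)
  have "(\<Sum>H | hyperplane n V H. dim_poly P H) =
      (\<Sum>H | hyperplane n V H. \<Sum>x\<in>?I V. if x \<subseteq> H then ?m x else 0)"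
  proof (rule sum.cong[OF refl])
    fix H assume "H \<in> {H. hyperplane n V H}"
    then have "?I H = {x \<in> ?I V. x \<subseteq> H}"
      by (auto simp: hyperplane_def)
    then show "dim_poly P H = (\<Sum>x\<in>?I V. if x \<subseteq> H then ?m x else 0)"
      unfolding dim_poly_def by (simp only: sum.inter_filter[OF finite_subfamily[OF P]])
  qed
  also have "\<dots> = (\<Sum>x\<in>?I V. \<Sum>H | hyperplane n V H. if x \<subseteq> H then ?m x else 0)"
    by (rule sum.swap)
  also have "\<dots> = (\<Sum>x\<in>?I V. of_nat (card {H. hyperplane n V H \<and> x \<subseteq> H}) * ?m x)"
    using fin by (simp add: sum.inter_filter[symmetric])
  finally have "smult (real ?q - 1) (\<Sum>H | hyperplane n V H. dim_poly P H) =
     (\<Sum>x\<in>?I V. smult (real ?q - 1) (of_nat (card {H. hyperplane n V H \<and> x \<subseteq> H}) * ?m x))"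
    by (simp add: smult_sum_right)
  also have "\<dots> = (\<Sum>x\<in>?I V. smult (real ?q ^ fs.dim V) (alpha_inv ?q (?m x)) - ?m x)"
  proof (rule sum.cong[OF refl])
    fix x assume x: "x \<in> ?I V"
    then have xs: "x \<in> subspaces n" "x \<subseteq> V"
      using P by auto
    have "real ?q ^ (fs.dim V - fs.dim x) = real ?q ^ fs.dim V / real ?q ^ fs.dim x"
      using dim_mono_subspaces[OF xs(1) V xs(2)] by (simp add: power_diff)
    then have e: "(real ?q - 1) * real (card {H. hyperplane n V H \<and> x \<subseteq> H}) =
       real ?q ^ fs.dim V / real ?q ^ fs.dim x - 1"
      using card_hyperplanes_over[OF V xs] by simp
    have "smult (real ?q - 1) (of_nat (card {H. hyperplane n V H \<and> x \<subseteq> H}) * ?m x) =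
        monom ((real ?q - 1) * real (card {H. hyperplane n V H \<and> x \<subseteq> H})) (fs.dim x)"
      by (simp add: of_nat_poly smult_monom)
    then show "smult (real ?q - 1) (of_nat (card {H. hyperplane n V H \<and> x \<subseteq> H}) * ?m x) =
       smult (real ?q ^ fs.dim V) (alpha_inv ?q (?m x)) - ?m x"
      unfolding e by (simp add: alpha_inv_monom smult_monom diff_monom)
  qed
  also have "\<dots> = smult (real ?q ^ fs.dim V) (alpha_inv ?q (sum ?m (?I V))) - sum ?m (?I V)"
    by (simp only: alpha_inv_sum smult_sum_right sum_subtractf)
  finally show ?thesis
    by (simp add: dim_poly_def)
qed

lemma coeff_indep_poly_eq_0:
  assumes "q_matroid n \<phi>" "V \<in> subspaces n" "\<phi> V < j"
  shows "coeff (dim_poly (indep_spaces n \<phi>) V) j = 0"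
proof -
  have "fs.dim x \<noteq> j" if "x \<in> indep_spaces n \<phi>" "x \<subseteq> V" for x
    using that assms q_matroidD(2)[OF assms(1) _ assms(2), of x] by (auto simp: indep_spaces_def)
  then show ?thesis
    by (simp add: dim_poly_def coeff_sum)
qed

text \<open>Forward substitution for \<open>c 0 * h 0 = g 0\<close> and
  \<open>c (k+1) * h (k+1) - d k * h k = g (k+1)\<close>. It only adds and divides, so positive
  \<open>c\<close> and nonnegative \<open>d\<close>, \<open>g\<close> give nonnegative
  \<open>h\<close>.\<close>

primrec bidiag_solve :: "(nat \<Rightarrow> real) \<Rightarrow> (nat \<Rightarrow> real) \<Rightarrow> (nat \<Rightarrow> real) \<Rightarrow> nat \<Rightarrow> real" where
  "bidiag_solve c d g 0 = g 0 / c 0"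
| "bidiag_solve c d g (Suc k) = (g (Suc k) + d k * bidiag_solve c d g k) / c (Suc k)"

text \<open>The solution \<open>p\<close> of the bidiagonal system has the same image as
  \<open>f\<close>. The operator scales \<open>t^j\<close> by \<open>q^n / q^j - 1\<close>, so its
  kernel is spanned by \<open>t^n\<close>, a monomial missing from \<open>f\<close> by assumption
  and from \<open>p\<close> because \<open>r < n\<close>.\<close>

lemma hyperplane_average_inverse:
  assumes q: "q > 1" and r: "r < n"
    and g: "\<And>k. k \<le> r \<Longrightarrow> 0 \<le> g k"
    and f: "smult (real q ^ n) (alpha_inv q f) - f = (\<Sum>k\<le>r. smult (g k) (Rpoly q r k))"
    and fn: "coeff f n = 0"
  shows "\<exists>h. (\<forall>k\<le>r. 0 \<le> h k) \<and> f = (\<Sum>k\<le>r. smult (h k) (Rpoly q r k))"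
proof -
  define c where "c = (\<lambda>k. real q ^ (n - k) - 1)"
  define d where "d = (\<lambda>k. real q ^ (n - k) - real q ^ (n - r))"
  define h where "h = bidiag_solve c d g"
  define p where "p = (\<Sum>k\<le>r. smult (h k) (Rpoly q r k))"
  have c: "c k > 0" if "k \<le> r" for k
    using that r q by (simp add: c_def)
  have d: "d k \<ge> 0" if "k \<le> r" for k
    using that r q by (simp add: d_def power_increasing)
  have h: "h (Suc k) * c (Suc k) - h k * d k = g (Suc k)" if "k < r" for k
    using c[of "Suc k"] that by (simp add: h_def field_simps)
  have h0: "h 0 * c 0 = g 0"
    using c[of 0] by (simp add: h_def)
  have h_nonneg: "0 \<le> h k" if "k \<le> r" for k
    using that
  proof (induction k)
    case 0
    then show ?case using g[of 0] c[of 0] by (simp add: h_def)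
  next
    case (Suc k)
    then show ?case using g[of "Suc k"] c[of "Suc k"] d[of k] by (simp add: h_def)
  qed
  have "smult (real q ^ n) (alpha_inv q p) - p =
     (\<Sum>k\<le>r. smult (h k) (smult (real q ^ n) (alpha_inv q (Rpoly q r k)) - Rpoly q r k))"
    by (simp add: p_def alpha_inv_sum_smult smult_sum_right smult_diff_right sum_subtractf mult.commute)
  also have "\<dots> = (\<Sum>k\<le>r. smult (h k * c k) (Rpoly q r k) - smult (h k * d k) (Rpoly q r (Suc k)))"
    using q r by (intro sum.cong refl)
      (simp add: Rpoly_hyperplane_average c_def d_def smult_diff_right)
  \<comment> \<open>The last term of the second sum is dropped because
    \<open>d r = 0\<close>.\<close>
  also have "\<dots> = (\<Sum>k\<le>r. smult (h k * c k) (Rpoly q r k)) - (\<Sum>k<r. smult (h k * d k) (Rpoly q r (Suc k)))"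
    by (simp add: sum_subtractf d_def flip: lessThan_Suc_atMost)
  also have "\<dots> = smult (h 0 * c 0) (Rpoly q r 0)
      + (\<Sum>k<r. smult (h (Suc k) * c (Suc k) - h k * d k) (Rpoly q r (Suc k)))"
    by (simp add: sum.atMost_shift sum_subtractf smult_diff_left)
  also have "\<dots> = (\<Sum>k\<le>r. smult (g k) (Rpoly q r k))"
    using h by (simp add: sum.atMost_shift h0)
  finally have eq: "smult (real q ^ n) (alpha_inv q p) - p = smult (real q ^ n) (alpha_inv q f) - f"
    by (simp add: f)
  have "f = p"
  proof (rule poly_eqI)
    fix j
    show "coeff f j = coeff p j"
    proof (cases "j = n")
      case True
      then show ?thesis
        using fn r by (simp add: p_def coeff_sum coeff_Rpoly_eq_0)
    next
      case False
      then have "real q ^ n \<noteq> real q ^ j"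
        using q by simp
      then have "real q ^ n / real q ^ j \<noteq> 1"
        using q by simp
      moreover have "real q ^ n / real q ^ j * coeff p j - coeff p j =
          real q ^ n / real q ^ j * coeff f j - coeff f j"
        using arg_cong[OF eq, of "\<lambda>f. coeff f j"] by (simp add: coeff_alpha_inv)
      then have "(real q ^ n / real q ^ j - 1) * (coeff f j - coeff p j) = 0"
        by (simp only: left_diff_distrib right_diff_distrib)
      ultimately show ?thesis
        by (metis eq_iff_diff_eq_0 mult_eq_0_iff)
    qed
  qed
  then show ?thesis
    using h_nonneg p_def by blast
qed

lemma hyperplane_extend_positive:
  assumes q: "q > 1" and r: "r < n" and h: "\<And>k. k \<le> r \<Longrightarrow> 0 \<le> h k"
    and f: "f = (\<Sum>k\<le>r. smult (h k) (Rpoly q r k))"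
  shows "\<exists>h'. (\<forall>k\<le>Suc r. 0 \<le> h' k) \<and>
    f + smult (real q ^ (n - 1)) ([:0, 1:] * alpha_inv q f) = (\<Sum>k\<le>Suc r. smult (h' k) (Rpoly q (Suc r) k))"
proof (intro exI conjI allI impI)
  \<comment> \<open>Each \<open>h k\<close> feeds both \<open>R_{r+1,k}\<close> and
    \<open>R_{r+1,k+1}\<close>, and \<open>?h\<close> collects the two shares. The cutoff in
    \<open>?a\<close> matters at \<open>k = r + 1\<close>, where nothing is known about
    \<open>h\<close>.\<close>
  let ?a = "\<lambda>k. if k \<le> r then h k / real q ^ k else 0"
  let ?b = "\<lambda>k. h k * (real q ^ (n - Suc r) - 1 / real q ^ k)"
  let ?h = "\<lambda>k. ?a k + (case k of 0 \<Rightarrow> 0 | Suc i \<Rightarrow> ?b i)"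
  show "0 \<le> ?h k" if "k \<le> Suc r" for k
  proof -
    have "1 / real q ^ i \<le> real q ^ (n - Suc r)" for i
    proof -
      have "1 / real q ^ i \<le> 1" "1 \<le> real q ^ (n - Suc r)"
        using q by simp_all
      then show ?thesis by linarith
    qed
    then show ?thesis
      using h that by (auto split: nat.splits intro!: add_nonneg_nonneg)
  qed
  have "f + smult (real q ^ (n - 1)) ([:0, 1:] * alpha_inv q f) =
     (\<Sum>k\<le>r. smult (h k) (Rpoly q r k + smult (real q ^ (n - 1)) ([:0, 1:] * alpha_inv q (Rpoly q r k))))"
    unfolding f alpha_inv_sum_smult sum_distrib_left smult_sum_right sum.distrib[symmetric]
    by (simp add: smult_add_right mult.commute)
  also have "\<dots> = (\<Sum>k\<le>r. smult (?a k) (Rpoly q (Suc r) k)) + (\<Sum>k\<le>r. smult (?b k) (Rpoly q (Suc r) (Suc k)))"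
    unfolding sum.distrib[symmetric] using q r
    by (intro sum.cong refl)
       (simp only: Rpoly_hyperplane_extend[of q _ r n] atMost_iff, simp add: smult_add_right)
  also have "\<dots> = (\<Sum>k\<le>Suc r. smult (?h k) (Rpoly q (Suc r) k))"
  proof -
    have "(\<Sum>k\<le>r. smult (?a k) (Rpoly q (Suc r) k)) = (\<Sum>k\<le>Suc r. smult (?a k) (Rpoly q (Suc r) k))"
      by simp
    moreover have "(\<Sum>k\<le>r. smult (?b k) (Rpoly q (Suc r) (Suc k))) =
        (\<Sum>k\<le>Suc r. smult (case k of 0 \<Rightarrow> 0 | Suc i \<Rightarrow> ?b i) (Rpoly q (Suc r) k))"
      by (subst sum.atMost_Suc_shift) simp
    ultimately show ?thesis
      by (simp only: smult_add_left sum.distrib)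
  qed
  finally show "f + smult (real q ^ (n - 1)) ([:0, 1:] * alpha_inv q f) =
      (\<Sum>k\<le>Suc r. smult (?h k) (Rpoly q (Suc r) k))" .
qed

text \<open>The rank of \<open>V\<close> exceeds that of a hyperplane by 0 or 1. If it never exceeds
  it, then \<open>\<phi> V = \<phi> H \<le> dim H < dim V\<close>.\<close>

lemma q_matroid_hyperplane_cases [consumes 2, case_names zero coloop dependent]:
  fixes V :: "(nat \<Rightarrow> 'a::{field,finite}) set"
  assumes \<phi>: "q_matroid n \<phi>" and V: "V \<in> subspaces n"
  obtains "V = {0}" | H where "hyperplane n V H" "\<phi> V = Suc (\<phi> H)"
    | H where "hyperplane n V H" "\<phi> V < fs.dim V" "\<And>H. hyperplane n V H \<Longrightarrow> \<phi> V = \<phi> H"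
proof -
  consider "V = {0}" | H where "hyperplane n V H"
    using hyperplane_exists[OF V zero_in_subspaces] zero_subset_subspace[OF V] by blast
  then show thesis
  proof cases
    case 2
    show thesis
    proof (cases "\<exists>H. hyperplane n V H \<and> \<phi> V = Suc (\<phi> H)")
      case False
      have eq: "\<phi> V = \<phi> H" if "hyperplane n V H" for H
        using False that q_matroid_hyperplane_le[OF \<phi> V that] q_matroidD(2)[OF \<phi> _ V, of H]
        by (fastforce simp: hyperplane_def)
      then have "\<phi> V < fs.dim V"
        using 2 q_matroidD(1)[OF \<phi>, of H] by (auto simp: hyperplane_def)
      then show thesis using 2 eq that(3) by blast
    qed (use that(2) in blast)
  qed (rule that(1))
qed

text \<open>The row index is \<open>\<phi> V\<close>, so that in the dependent case all hyperplanes
  use the same row as \<open>V\<close>. That \<open>\<phi> V\<close> is the largest dimension of an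
  independent space is settled separately by \<open>indep_basis_exists\<close>.\<close>

theorem indep_poly_positive:
  fixes V :: "(nat \<Rightarrow> 'a::{field,finite}) set"
  assumes \<phi>: "q_matroid n \<phi>" and V: "V \<in> subspaces n"
  shows "\<exists>h. (\<forall>k\<le>\<phi> V. 0 \<le> h k) \<and>
    dim_poly (indep_spaces n \<phi>) V = (\<Sum>k\<le>\<phi> V. smult (h k) (Rpoly CARD('a) (\<phi> V) k))"
  using V
proof (induction "fs.dim V" arbitrary: V rule: less_induct)
  case (less V)
  note q = card_field_gt_1[where 'a='a]
  have IH: "\<exists>h. (\<forall>k\<le>\<phi> H. 0 \<le> h k) \<and>
    dim_poly (indep_spaces n \<phi>) H = (\<Sum>k\<le>\<phi> H. smult (h k) (Rpoly CARD('a) (\<phi> H) k))" if "hyperplane n V H" for H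
    using that less.hyps[of H] by (simp add: hyperplane_def)
  from \<phi> less.prems show ?case
  proof (cases rule: q_matroid_hyperplane_cases)
    case zero
    have "{x. x \<in> indep_spaces n \<phi> \<and> x \<subseteq> V} = {{0}}"
      using zero zero_indep[OF \<phi>] zero_subset_subspace by (auto simp: indep_spaces_def)
    moreover have "\<phi> V = 0"
      using zero zero_indep[OF \<phi>] by (simp add: indep_spaces_def dim_zero_space)
    ultimately show ?thesis
      by (auto simp: dim_poly_def dim_zero_space Rpoly_diag intro!: exI[of _ "\<lambda>_. 1"])
  next
    case (coloop H)
    then obtain h where h: "\<forall>k\<le>\<phi> H. 0 \<le> h k"
      "dim_poly (indep_spaces n \<phi>) H = (\<Sum>k\<le>\<phi> H. smult (h k) (Rpoly CARD('a) (\<phi> H) k))"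
      using IH by blast
    have "\<phi> H < fs.dim V" "fs.dim H = fs.dim V - 1"
      using q_matroidD(1)[OF \<phi> less.prems] coloop by (auto simp: hyperplane_def)
    then show ?thesis
      using hyperplane_extend_positive[OF q _ _ h(2), of "fs.dim V"] h(1)
        dim_poly_hyperplane_extend[OF indep_spaces_subset less.prems coloop(1)
          indep_iff_hyperplane_section[OF \<phi> less.prems coloop]] coloop(2) by simp
  next
    case (dependent H)
    define r where "r = \<phi> V"
    have "\<forall>H. \<exists>h. hyperplane n V H \<longrightarrow> (\<forall>k\<le>r. 0 \<le> h k) \<and>
      dim_poly (indep_spaces n \<phi>) H = (\<Sum>k\<le>r. smult (h k) (Rpoly CARD('a) r k))"
      using IH dependent(3) unfolding r_def by metis
    then obtain h where h: "\<And>H k. hyperplane n V H \<Longrightarrow> k \<le> r \<Longrightarrow> 0 \<le> h H k"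
      "\<And>H. hyperplane n V H \<Longrightarrow> dim_poly (indep_spaces n \<phi>) H = (\<Sum>k\<le>r. smult (h H k) (Rpoly CARD('a) r k))"
      by metis
    \<comment> \<open>The coefficients of \<open>(q - 1)\<close> times the sum of the hyperplane
      polynomials, hence the right-hand side of the bidiagonal system for \<open>V\<close>.\<close>
    define g where "g = (\<lambda>k. (real CARD('a) - 1) * (\<Sum>H | hyperplane n V H. h H k))"
    have "(\<Sum>H | hyperplane n V H. dim_poly (indep_spaces n \<phi>) H) =
        (\<Sum>H | hyperplane n V H. \<Sum>k\<le>r. smult (h H k) (Rpoly CARD('a) r k))"
      using h(2) by simp
    also have "\<dots> = (\<Sum>k\<le>r. \<Sum>H | hyperplane n V H. smult (h H k) (Rpoly CARD('a) r k))"
      by (rule sum.swap)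
    also have "\<dots> = (\<Sum>k\<le>r. smult (\<Sum>H | hyperplane n V H. h H k) (Rpoly CARD('a) r k))"
      by (simp only: smult_sum)
    finally have "smult (real CARD('a) - 1) (\<Sum>H | hyperplane n V H. dim_poly (indep_spaces n \<phi>) H) =
        (\<Sum>k\<le>r. smult (g k) (Rpoly CARD('a) r k))"
      by (simp add: g_def smult_sum_right)
    then have "smult (real CARD('a) ^ fs.dim V) (alpha_inv CARD('a) (dim_poly (indep_spaces n \<phi>) V))
        - dim_poly (indep_spaces n \<phi>) V = (\<Sum>k\<le>r. smult (g k) (Rpoly CARD('a) r k))"
      using dim_poly_hyperplane_average[OF indep_spaces_subset less.prems, of \<phi>] by simp
    moreover have "0 \<le> g k" if "k \<le> r" for k
      using h(1) that q by (auto simp: g_def intro!: mult_nonneg_nonneg sum_nonneg)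
    ultimately show ?thesis
      using hyperplane_average_inverse[OF q, of r "fs.dim V" g] dependent(2)
        coeff_indep_poly_eq_0[OF \<phi> less.prems dependent(2)] unfolding r_def by blast
  qed
qed

text \<open>If the rank jumps from \<open>H\<close> to \<open>V\<close>, a basis of \<open>H\<close>
  is enlarged by any vector outside \<open>H\<close>; otherwise a basis of a hyperplane already has
  the right dimension.\<close>

lemma indep_basis_exists:
  fixes V :: "(nat \<Rightarrow> 'a::{field,finite}) set"
  assumes \<phi>: "q_matroid n \<phi>" and V: "V \<in> subspaces n"
  shows "\<exists>x\<in>indep_spaces n \<phi>. x \<subseteq> V \<and> fs.dim x = \<phi> V"
  using V
proof (induction "fs.dim V" arbitrary: V rule: less_induct)
  case (less V)
  have IH: "\<exists>x\<in>indep_spaces n \<phi>. x \<subseteq> H \<and> fs.dim x = \<phi> H" if "hyperplane n V H" for H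
    using that less.hyps[of H] by (simp add: hyperplane_def)
  from \<phi> less.prems show ?case
  proof (cases rule: q_matroid_hyperplane_cases)
    case zero
    then show ?thesis
      using zero_indep[OF \<phi>] by (auto simp: indep_spaces_def)
  next
    case (coloop H)
    then have Hs: "H \<in> subspaces n" "H \<subseteq> V" "fs.dim V = Suc (fs.dim H)"
      by (auto simp: hyperplane_def)
    obtain v where v: "v \<in> V" "v \<notin> H"
      using hyperplane_psubset[OF coloop(1)] by blast
    obtain x where x: "x \<in> indep_spaces n \<phi>" "x \<subseteq> H" "fs.dim x = \<phi> H"
      using IH coloop by blast
    have xs: "x \<in> subspaces n" "x \<subseteq> V" "v \<notin> x"
      using x Hs v by (auto simp: indep_spaces_def)
    note y = span_insert_subspace[OF less.prems xs(1,2) v(1)]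
    have "\<not> fs.span (insert v x) \<subseteq> H"
      using y(4) v(2) by blast
    then have "fs.span (insert v x) \<in> indep_spaces n \<phi>"
      using indep_iff_hyperplane_section[OF \<phi> less.prems coloop y(1,2)] x
        span_insert_Int_hyperplane[OF less.prems coloop(1) xs(1) x(2) v] by simp
    moreover have "fs.dim (fs.span (insert v x)) = \<phi> V"
      using dim_span_insert[OF less.prems xs(1,2) v(1) xs(3)] x(3) coloop(2) by linarith
    ultimately show ?thesis using y(2) by blast
  next
    case (dependent H)
    obtain x where "x \<in> indep_spaces n \<phi>" "x \<subseteq> H" "fs.dim x = \<phi> V"
      using IH[OF dependent(1)] unfolding dependent(3)[OF dependent(1)] by blast
    then show ?thesis
      using hyperplane_psubset[OF dependent(1)] by blast
  qed
qed

lemma ideal_rank_indep_spaces: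
  fixes \<phi> :: "(nat \<Rightarrow> 'a::{field,finite}) set \<Rightarrow> nat"
  assumes \<phi>: "q_matroid n \<phi>"
  shows "ideal_rank (indep_spaces n \<phi>) = \<phi> (coord_space n)"
  unfolding ideal_rank_def
proof (rule Max_eqI)
  show "finite (fs.dim ` indep_spaces n \<phi>)"
    using finite_subfamily[OF indep_spaces_subset, of n \<phi> "\<lambda>_. True"] by simp
  show "\<phi> (coord_space n) \<in> fs.dim ` indep_spaces n \<phi>"
    using indep_basis_exists[OF \<phi> coord_space_in_subspaces] by (metis imageI)
  fix d assume "d \<in> fs.dim ` indep_spaces n \<phi>"
  then obtain x where x: "x \<in> subspaces n" "\<phi> x = d"
    by (auto simp: indep_spaces_def)
  then show "d \<le> \<phi> (coord_space n)"
    using q_matroidD(2)[OF \<phi> x(1) coord_space_in_subspaces subspacesD(2)[OF x(1)]] by simp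
qed

lemma Bq_positive_indep_spaces:
  fixes \<phi> :: "(nat \<Rightarrow> 'a::{field,finite}) set \<Rightarrow> nat"
  assumes \<phi>: "q_matroid n \<phi>"
  shows "Bq_positive CARD('a) n (indep_spaces n \<phi>)"
proof -
  have "order_ideal n (indep_spaces n \<phi>)"
    unfolding order_ideal_def using indep_subspace[OF \<phi>] indep_spaces_subset by blast
  moreover have "{x. x \<in> indep_spaces n \<phi> \<and> x \<subseteq> coord_space n} = indep_spaces n \<phi>"
    by (auto simp: indep_spaces_def subspaces_def)
  ultimately show ?thesis
    using indep_poly_positive[OF \<phi> coord_space_in_subspaces] zero_indep[OF \<phi>]
    unfolding Bq_positive_def ideal_rank_indep_spaces[OF \<phi>] dim_poly_def
    by auto
qed

section \<open>Real-rootedness from a pointwise sector condition\<close>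

text \<open>The signed area \<open>|a| |b| sin(arg b - arg a)\<close>: it is nonnegative when
  \<open>b\<close> is reached from \<open>a\<close> by a counterclockwise turn of at most a half
  circle.\<close>

definition cross :: "complex \<Rightarrow> complex \<Rightarrow> real" where
  "cross a b = Im (b * cnj a)"

lemma cross_add: "cross (a + b) c = cross a c + cross b c" "cross a (b + c) = cross a b + cross a c"
  by (simp_all add: cross_def algebra_simps)

lemma cross_self [simp]: "cross a a = 0"
  by (simp add: cross_def)

lemma cross_zero [simp]: "cross 0 a = 0" "cross a 0 = 0"
  by (simp_all add: cross_def)

lemma cross_mult: "cross (s * a) (s * b) = (cmod s)\<^sup>2 * cross a b"
  unfolding cmod_power2 by (simp add: cross_def algebra_simps power2_eq_square)

lemma cross_rotate: "cross a (s * a) = Im s * (cmod a)\<^sup>2"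
  unfolding cmod_power2 by (simp add: cross_def algebra_simps power2_eq_square)

lemma cross_of_real: "cross (of_real r * a) b = r * cross a b" "cross a (of_real r * b) = r * cross a b"
  by (simp_all add: cross_def algebra_simps)

lemma cross_sum_left: "cross (sum f A) b = (\<Sum>x\<in>A. cross (f x) b)"
  by (simp add: cross_def sum_distrib_left)

lemma cross_sum_right: "cross a (sum f A) = (\<Sum>x\<in>A. cross a (f x))"
  by (simp add: cross_def sum_distrib_right)

text \<open>
  \<open>fan s m w\<close> says that \<open>w 0, \<dots>, w m, s * w 0, \<dots>, s * w m\<close> occur in this order of argument.
  It is a pointwise form of interlacing: by Hermite--Biehler, real polynomials \<open>f\<close>, \<open>g\<close> interlace
  if \<open>cross (f z) (g z)\<close> has constant sign on the upper half plane.
\<close>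

definition fan :: "complex \<Rightarrow> nat \<Rightarrow> (nat \<Rightarrow> complex) \<Rightarrow> bool" where
  "fan s m w \<longleftrightarrow> w 0 \<noteq> 0 \<and>
     (\<forall>j\<le>m. \<forall>i<j. 0 \<le> cross (w i) (w j) \<and> 0 \<le> cross (w j) (s * w i))"

lemma fan_cross:
  assumes "fan s m w" "i \<le> j" "j \<le> m" "Im s > 0"
  shows "0 \<le> cross (w i) (w j)" "0 \<le> cross (w j) (s * w i)"
  using assms by (cases "i = j"; auto simp: fan_def cross_rotate)+

lemma fan_mult:
  assumes "fan s m w" "c \<noteq> 0"
  shows "fan s m (\<lambda>k. c * w k)"
proof -
  have "cross (c * a) (s * (c * b)) = (cmod c)\<^sup>2 * cross a (s * b)" for a b
    using cross_mult[of c a "s * b"] by (simp add: mult_ac)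
  then show ?thesis
    using assms by (simp add: fan_def cross_mult)
qed

text \<open>Every \<open>w i\<close> has nonnegative \<open>cross\<close> with
  \<open>s * w 0\<close>, and \<open>w 0\<close> itself a positive one, so the combination cannot
  vanish.\<close>

lemma fan_combination:
  assumes "fan s m w" "Im s > 0" "\<And>i. i \<le> m \<Longrightarrow> 0 \<le> h i" "h 0 > 0"
  shows "(\<Sum>i\<le>m. complex_of_real (h i) * w i) \<noteq> 0"
proof
  assume "(\<Sum>i\<le>m. complex_of_real (h i) * w i) = 0"
  then have "0 = cross (\<Sum>i\<le>m. complex_of_real (h i) * w i) (s * w 0)"
    by simp
  also have "\<dots> = (\<Sum>i\<le>m. h i * cross (w i) (s * w 0))"
    by (simp add: cross_sum_left cross_of_real)
  also have "\<dots> \<ge> (\<Sum>i\<in>{0}. h i * cross (w i) (s * w 0))"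
    using assms by (intro sum_mono2) (auto intro!: mult_nonneg_nonneg fan_cross)
  moreover have "h 0 * cross (w 0) (s * w 0) > 0"
    using assms by (simp add: cross_rotate fan_def)
  ultimately show False by simp
qed

text \<open>Here \<open>a\<close>, \<open>b\<close>, \<open>c\<close> stand for three consecutive
  blocks of a sum. The common part \<open>p = s * a + c\<close> lies between \<open>b\<close> and
  \<open>s * b\<close> in argument, and bilinear expansion around \<open>p\<close> gives both
  claims.\<close>

lemma cross_blocks:
  assumes "Im s > 0"
    and "0 \<le> cross a b" "0 \<le> cross b c"
    and "0 \<le> cross b (s * a)" "0 \<le> cross c (s * b)"
  shows "0 \<le> cross (s * a + b + c) (s * a + s * b + c)" (is ?A)
    and "0 \<le> cross (s * a + s * b + c) (s * (s * a + b + c))" (is ?B)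
proof -
  define p where "p = s * a + c"
  have 1: "0 \<le> cross p (s * b)"
    using assms by (simp add: p_def cross_add cross_mult)
  have 2: "0 \<le> cross b p"
    using assms by (simp add: p_def cross_add)
  have "cross (p + b) (p + s * b) = cross p (s * b) + cross b p + cross b (s * b)"
    by (simp add: cross_add)
  then show ?A
    using 1 2 assms(1) by (simp add: p_def add_ac cross_rotate)
  have "cross (p + s * b) (s * (p + b)) =
      cross p (s * p) + cross p (s * b) + (cmod s)\<^sup>2 * cross b p"
    by (simp add: cross_add distrib_left cross_mult)
  then show ?B
    using 1 2 assms(1) by (simp add: p_def add_ac cross_rotate)
qed

text \<open>The two forms of the recurrence: the first, up to the factor \<open>1 + z\<close>, for a
  selected rank, the second for an unselected one.\<close>

lemma fan_step:
  fixes w :: "nat \<Rightarrow> complex" and c :: "nat \<Rightarrow> real"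
  assumes w: "fan s m w" and s: "Im s > 0" and c: "\<And>i. i \<le> m \<Longrightarrow> 0 \<le> c i" "c 0 > 0"
  defines "u \<equiv> \<lambda>i. of_real (c i) * w i"
  shows "fan s (Suc m) (\<lambda>k. s * sum u {..<k} + sum u {k..m})" (is ?A)
    and "fan s (Suc m) (\<lambda>k. sum u {k..m})" (is ?B)
proof -
  \<comment> \<open>By bilinearity the fan inequalities pass to sums over index blocks
    \<open>I\<close> and \<open>J\<close> with \<open>I\<close> preceding \<open>J\<close>.\<close>
  have cr: "0 \<le> cross (sum u I) (sum u J)" "0 \<le> cross (sum u J) (s * sum u I)"
    if "\<And>i j. i \<in> I \<Longrightarrow> j \<in> J \<Longrightarrow> i \<le> j \<and> j \<le> m" for I J
  proof -
    have "0 \<le> cross (u i) (u j) \<and> 0 \<le> cross (u j) (s * u i)" if "i \<in> I" "j \<in> J" for i j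
    proof -
      have "cross (u j) (s * u i) = c j * (c i * cross (w j) (s * w i))"
        unfolding u_def cross_of_real(1) mult.left_commute[of s] cross_of_real(2) by simp
      moreover have "cross (u i) (u j) = c i * (c j * cross (w i) (w j))"
        unfolding u_def cross_of_real by (rule mult.left_commute)
      moreover have "i \<le> j" "j \<le> m" "i \<le> m"
        using \<open>\<And>i j. i \<in> I \<Longrightarrow> j \<in> J \<Longrightarrow> i \<le> j \<and> j \<le> m\<close> that by (auto intro: order_trans)
      ultimately show ?thesis
        using fan_cross[OF w _ _ s, of i j] c by simp
    qed
    then show "0 \<le> cross (sum u I) (sum u J)" "0 \<le> cross (sum u J) (s * sum u I)"
      unfolding sum_distrib_left cross_sum_left cross_sum_right
      by (simp_all add: sum_nonneg)
  qed
  have nz: "sum u {0..m} \<noteq> 0"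
    using fan_combination[OF w s, of c] c unfolding u_def atLeast0AtMost by blast
  have split: "sum u {..<l} = sum u {..<k} + sum u {k..<l}"
    "sum u {k..m} = sum u {k..<l} + sum u {l..m}" if "k < l" "l \<le> Suc m" for k l
    using that by (simp_all add: sum.union_disjoint[symmetric] ivl_disj_un ivl_disj_int)
      (auto intro!: sum.cong arg_cong[of _ _ "sum u"])
  show ?A
    unfolding fan_def
  proof (intro conjI allI impI)
    fix k l assume kl: "k < l" "l \<le> Suc m"
    have blocks: "0 \<le> cross (sum u {..<k}) (sum u {k..<l})"
        "0 \<le> cross (sum u {k..<l}) (sum u {l..m})"
        "0 \<le> cross (sum u {k..<l}) (s * sum u {..<k})"
        "0 \<le> cross (sum u {l..m}) (s * sum u {k..<l})"
      using kl by (auto intro!: cr)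
    show "0 \<le> cross (s * sum u {..<k} + sum u {k..m}) (s * sum u {..<l} + sum u {l..m})"
      "0 \<le> cross (s * sum u {..<l} + sum u {l..m}) (s * (s * sum u {..<k} + sum u {k..m}))"
      using cross_blocks[OF s blocks] unfolding split[OF kl] distrib_left add.assoc by simp_all
  qed (use nz in simp)
  show ?B
    unfolding fan_def
  proof (intro conjI allI impI)
    fix k l assume kl: "k < l" "l \<le> Suc m"
    have "0 \<le> cross (sum u {k..<l}) (sum u {l..m})" "0 \<le> cross (sum u {l..m}) (s * sum u {k..<l})"
      using kl by (auto intro!: cr)
    then show "0 \<le> cross (sum u {k..m}) (sum u {l..m})"
      "0 \<le> cross (sum u {l..m}) (s * sum u {k..m})"
      using s unfolding split(2)[OF kl] distrib_left cross_add cross_rotate by simp_all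
  qed (use nz in simp)
qed

text \<open>The polynomials \<open>A_{m,k}\<close> of the overview, meant for
  \<open>k \<le> m\<close>. They are introduced by their recurrence, to which
  \<open>fan_step\<close> applies; \<open>chainR_eq_chain_lift\<close> identifies them as images of
  \<open>Rpoly\<close>.\<close>

primrec chainR :: "nat \<Rightarrow> nat set \<Rightarrow> nat \<Rightarrow> nat \<Rightarrow> real poly" where
  "chainR q S 0 = (\<lambda>k. if k = 0 then 1 + (if 0 \<in> S then [:0, 1:] else 0) else 0)"
| "chainR q S (Suc m) = (\<lambda>k.
     (if Suc m \<in> S then [:0, 1:] * (\<Sum>i\<le>m. smult (real q ^ i) (chainR q S m i)) else 0)
     + (\<Sum>i\<in>{k..m}. smult (real q ^ i) (chainR q S m i)))"

abbreviation cpoly :: "real poly \<Rightarrow> complex \<Rightarrow> complex" where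
  "cpoly p \<equiv> poly (map_poly complex_of_real p)"

lemma cpoly_simps [simp]:
  "cpoly (smult c p) z = of_real c * cpoly p z" "cpoly 0 z = 0" "cpoly 1 z = 1"
  "cpoly (pCons c p) z = of_real c + z * cpoly p z"
  by (simp_all add: map_poly_smult map_poly_pCons)

lemma cpoly_add [simp]: "cpoly (p + p') z = cpoly p z + cpoly p' z"
proof -
  have "map_poly complex_of_real (p + p') = map_poly of_real p + map_poly of_real p'"
    by (rule poly_eqI) (simp add: coeff_map_poly)
  then show ?thesis by simp
qed

lemma cpoly_sum: "cpoly (sum f A) z = (\<Sum>x\<in>A. cpoly (f x) z)"
  by (induction A rule: infinite_finite_induct) auto

lemma Im_pos_div_1_plus:
  assumes "Im z > 0"
  shows "1 + z \<noteq> 0" "Im (z / (1 + z)) > 0"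
proof -
  show "1 + z \<noteq> 0"
    using assms by (auto simp: complex_eq_iff)
  have "Im (z / (1 + z)) = Im z / ((1 + Re z)\<^sup>2 + (Im z)\<^sup>2)"
    by (simp add: Im_divide algebra_simps)
  then show "Im (z / (1 + z)) > 0"
    using assms by (simp add: sum_power2_gt_zero_iff)
qed

lemma fan_chainR:
  assumes "q > 0" "Im z > 0"
  shows "fan (z / (1 + z)) m (\<lambda>k. cpoly (chainR q S m k) z)"
proof (induction m)
  case 0
  show ?case
    using Im_pos_div_1_plus(1)[OF assms(2)] by (simp add: fan_def)
next
  case (Suc m)
  define s where "s = z / (1 + z)"
  define u where "u = (\<lambda>i. of_real (real q ^ i) * cpoly (chainR q S m i) z)"
  note z1 = Im_pos_div_1_plus(1)[OF assms(2)]
  have s: "Im s > 0"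
    using Im_pos_div_1_plus(2)[OF assms(2)] by (simp add: s_def)
  have fans: "fan s (Suc m) (\<lambda>k. s * sum u {..<k} + sum u {k..m})" "fan s (Suc m) (\<lambda>k. sum u {k..m})"
    using fan_step[of s m "\<lambda>k. cpoly (chainR q S m k) z" "\<lambda>i. real q ^ i"] Suc s assms(1)
    unfolding s_def u_def by simp_all
  show ?case
  proof (cases "Suc m \<in> S")
    case True
    \<comment> \<open>The terms with \<open>i < k\<close> carry the factor \<open>z\<close> and the
      others \<open>1 + z\<close>; dividing by \<open>1 + z\<close> turns these into
      \<open>s\<close> and 1.\<close>
    have "cpoly (chainR q S (Suc m) k) z = (1 + z) * (s * sum u {..<k} + sum u {k..m})"
      if "k \<le> Suc m" for k
    proof -
      have "{..m} = {..<k} \<union> {k..m}"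
        using that by auto
      then have "sum u {..m} = sum u {..<k} + sum u {k..m}"
        by (simp add: sum.union_disjoint ivl_disj_int)
      then show ?thesis
        using True z1 by (simp add: cpoly_sum flip: u_def) (simp add: u_def s_def field_simps)
    qed
    then show ?thesis
      using fan_mult[OF fans(1) z1] by (simp add: fan_def flip: s_def del: chainR.simps)
  next
    case False
    then show ?thesis
      using fans(2) by (simp add: cpoly_sum u_def flip: s_def)
  qed
qed

lemma real_rooted_upper:
  assumes "\<And>z. Im z > 0 \<Longrightarrow> cpoly p z \<noteq> 0"
  shows "real_rooted p"
  unfolding real_rooted_def
proof (intro allI impI)
  fix z assume z: "cpoly p z = 0"
  have "cpoly p (cnj z) = cnj (cpoly p z)"
    by (simp add: poly_cnj_real coeff_map_poly)
  then have "cpoly p (cnj z) = 0"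
    using z by simp
  then have "\<not> Im z > 0" "\<not> Im z < 0"
    using assms[of z] assms[of "cnj z"] z by auto
  then show "z \<in> \<real>"
    by (simp add: complex_is_Real_iff)
qed

lemma real_rooted_chainR_combination:
  assumes "q > 0" "\<And>k. k \<le> r \<Longrightarrow> 0 \<le> h k" "h 0 > 0"
  shows "real_rooted (\<Sum>k\<le>r. smult (h k) (chainR q S r k))"
proof (rule real_rooted_upper)
  fix z :: complex assume z: "Im z > 0"
  show "cpoly (\<Sum>k\<le>r. smult (h k) (chainR q S r k)) z \<noteq> 0"
    using fan_combination[OF fan_chainR[OF assms(1) z] Im_pos_div_1_plus(2)[OF z]] assms(2,3) by (simp add: cpoly_sum)
qed

section \<open>Chain polynomials\<close>

lemma chain_insert_greatest:
  fixes x :: "'b::order"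
  assumes "Complete_Partial_Order.chain (\<le>) C" "\<And>y. y \<in> C \<Longrightarrow> y < x"
  shows "Complete_Partial_Order.chain (\<le>) (insert x C)"
  using assms unfolding chain_def by (auto intro: less_imp_le)

lemma finite_chain_greatest:
  fixes C :: "'b::order set"
  assumes "finite C" "C \<noteq> {}" "Complete_Partial_Order.chain (\<le>) C"
  obtains x where "x \<in> C" "\<And>y. y \<in> C - {x} \<Longrightarrow> y < x"
proof -
  obtain x where x: "x \<in> C" "\<And>y. y \<in> C \<Longrightarrow> x \<le> y \<Longrightarrow> x = y"
    using finite_has_maximal[OF assms(1,2)] by blast
  have "y < x" if "y \<in> C - {x}" for y
    using that x chainD[OF assms(3), of x y] by (auto simp: less_le)
  then show thesis
    using that x(1) by blast
qed

text \<open>Nonempty chains are sorted by their greatest element \<open>x\<close>; removing it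
  leaves an arbitrary chain strictly below \<open>x\<close>.\<close>

lemma chain_poly_rec:
  fixes Q :: "'b::order set"
  assumes "finite Q"
  shows "chain_poly Q = 1 + (\<Sum>x\<in>Q. [:0, 1:] * chain_poly {y \<in> Q. y < x})"
proof -
  let ?C = "\<lambda>Q :: 'b set. {C. C \<subseteq> Q \<and> Complete_Partial_Order.chain (\<le>) C}"
  let ?B = "\<lambda>x. {y \<in> Q. y < x}"
  let ?m = "\<lambda>C :: 'b set. monom (1 :: real) (card C)"
  have fin: "finite (?C R)" if "R \<subseteq> Q" for R
    using finite_subset[OF that assms] by simp
  have "?C Q = insert {} (\<Union>x\<in>Q. insert x ` ?C (?B x))"
  proof (intro equalityI subsetI)
    fix C assume C: "C \<in> ?C Q"
    show "C \<in> insert {} (\<Union>x\<in>Q. insert x ` ?C (?B x))"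
    proof (cases "C = {}")
      case False
      then obtain x where x: "x \<in> C" "\<And>y. y \<in> C - {x} \<Longrightarrow> y < x"
        using C finite_chain_greatest[of C] finite_subset[OF _ assms] by blast
      have "C - {x} \<in> ?C (?B x)"
        using C x chain_subset[of "(\<le>)" C "C - {x}"] by blast
      moreover have "C = insert x (C - {x})"
        using x by blast
      ultimately show ?thesis
        using C x(1) by blast
    qed simp
  next
    fix C assume "C \<in> insert {} (\<Union>x\<in>Q. insert x ` ?C (?B x))"
    then consider "C = {}" | x D where "x \<in> Q" "D \<in> ?C (?B x)" "C = insert x D"
      by blast
    then show "C \<in> ?C Q"
    proof cases
      case (2 x D)
      then have "y < x" if "y \<in> D" for y
        using that by blast
      then show ?thesis
        using 2 chain_insert_greatest[of D x] by blast
    qed (simp add: chain_empty)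
  qed
  then have "chain_poly Q = ?m {} + sum ?m (\<Union>x\<in>Q. insert x ` ?C (?B x))"
    unfolding chain_poly_def using fin assms by (simp only:) (subst sum.insert; auto)
  also have "sum ?m (\<Union>x\<in>Q. insert x ` ?C (?B x)) = (\<Sum>x\<in>Q. sum ?m (insert x ` ?C (?B x)))"
  proof (rule sum.UNION_disjoint[OF assms])
    show "\<forall>x\<in>Q. finite (insert x ` ?C (?B x))"
      using fin by auto
    show "\<forall>x\<in>Q. \<forall>y\<in>Q. x \<noteq> y \<longrightarrow> insert x ` ?C (?B x) \<inter> insert y ` ?C (?B y) = {}"
    proof (intro ballI impI, rule ccontr)
      fix x y assume "x \<noteq> y" "insert x ` ?C (?B x) \<inter> insert y ` ?C (?B y) \<noteq> {}"
      then obtain C where "C \<in> insert x ` ?C (?B x)" "C \<in> insert y ` ?C (?B y)"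
        by (elim ex_in_conv[THEN iffD2, elim_format] exE IntE)
      then obtain D E where D: "C = insert x D" "D \<subseteq> ?B x" and E: "C = insert y E" "E \<subseteq> ?B y"
        by (elim imageE CollectE conjE)
      have "x \<in> E"
        using D(1) E(1) \<open>x \<noteq> y\<close> by (metis insertCI insertE)
      moreover have "y \<in> D"
        using D(1) E(1) \<open>x \<noteq> y\<close> by (metis insertCI insertE)
      ultimately have "x < y" "y < x"
        using D(2) E(2) by auto
      then show False by simp
    qed
  qed
  also have "\<dots> = (\<Sum>x\<in>Q. [:0, 1:] * chain_poly (?B x))"
  proof (rule sum.cong[OF refl])
    fix x assume "x \<in> Q"
    have "inj_on (insert x) (?C (?B x))"
      by (rule inj_onI) (use insert_ident[of x] in blast)
    then have "sum ?m (insert x ` ?C (?B x)) = (\<Sum>C\<in>?C (?B x). ?m (insert x C))"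
      by (simp add: sum.reindex)
    also have "\<dots> = (\<Sum>C\<in>?C (?B x). [:0, 1:] * ?m C)"
    proof (rule sum.cong[OF refl])
      fix C assume "C \<in> ?C (?B x)"
      then have "finite C" "x \<notin> C"
        using finite_subset[of C Q] assms by auto
      then show "?m (insert x C) = [:0, 1:] * ?m C"
        by (simp add: monom_Suc)
    qed
    finally show "sum ?m (insert x ` ?C (?B x)) = [:0, 1:] * chain_poly (?B x)"
      by (simp only: chain_poly_def sum_distrib_left)
  qed
  finally show ?thesis by simp
qed

text \<open>For the family of all subspaces the extension condition holds at every hyperplane. In
  \<open>Rpoly_hyperplane_extend\<close> with \<open>k = 0\<close> and \<open>n = r + 1\<close> the
  second coefficient is 0, so only \<open>R_{r+1,0}\<close> remains.\<close>

lemma dim_poly_subspaces: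
  fixes V :: "(nat \<Rightarrow> 'a::{field,finite}) set"
  assumes "V \<in> subspaces n"
  shows "dim_poly (subspaces n) V = Rpoly CARD('a) (fs.dim V) 0"
  using assms
proof (induction "fs.dim V" arbitrary: V rule: less_induct)
  case (less V)
  note V = less.prems
  show ?case
  proof (cases "V = {0}")
    case True
    then have "{x \<in> subspaces n. x \<subseteq> V} = {{0}}"
      using zero_subset_subspace[of _ n] zero_in_subspaces[of n] by auto
    then show ?thesis
      using True by (simp add: dim_poly_def dim_zero_space Rpoly_diag)
  next
    case False
    then obtain H where H: "hyperplane n V H"
      using hyperplane_exists[OF V zero_in_subspaces] zero_subset_subspace[OF V] by blast
    then have Hs: "H \<in> subspaces n" "fs.dim V = Suc (fs.dim H)"
      by (auto simp: hyperplane_def)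
    show ?thesis
      using dim_poly_hyperplane_extend[OF order_refl V H] less.hyps[of H] Hs
        Rpoly_hyperplane_extend[of "CARD('a)" 0 "fs.dim H" "fs.dim V"]
      by (simp add: Int_in_subspaces)
  qed
qed

text \<open>
  \<open>below_chains q S j\<close> is the chain polynomial of the elements of rank in \<open>S\<close> strictly below an
  element of rank \<open>j\<close>, and \<open>chain_lift\<close> is the linear map that sends \<open>t\<^sup>j\<close> to the generating
  polynomial of the chains whose top element is a given element of rank \<open>j\<close>. The bound \<open>N\<close> only
  serves to make it linear on all polynomials.
\<close>

definition below_chains :: "nat \<Rightarrow> nat set \<Rightarrow> nat \<Rightarrow> real poly" where
  "below_chains q S j =
     (case j of 0 \<Rightarrow> 1 | Suc m \<Rightarrow> \<Sum>i\<le>m. smult (real q ^ i) (chainR q S m i))"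

definition chain_lift :: "nat \<Rightarrow> nat \<Rightarrow> nat set \<Rightarrow> real poly \<Rightarrow> real poly" where
  "chain_lift N q S f = (\<Sum>j\<in>S \<inter> {..N}. smult (coeff f j) ([:0, 1:] * below_chains q S j))"

lemma chain_lift_linear:
  "chain_lift N q S (f + g) = chain_lift N q S f + chain_lift N q S g"
  "chain_lift N q S (f - g) = chain_lift N q S f - chain_lift N q S g"
  "chain_lift N q S (smult c f) = smult c (chain_lift N q S f)"
  by (simp_all only: chain_lift_def coeff_add coeff_diff coeff_smult smult_add_left smult_diff_left
      smult_smult smult_sum_right sum.distrib sum_subtractf)

lemma chain_lift_sum: "chain_lift N q S (sum f A) = (\<Sum>x\<in>A. chain_lift N q S (f x))"
proof -
  have "chain_lift N q S 0 = 0"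
    by (simp add: chain_lift_def)
  then show ?thesis
    by (induction A rule: infinite_finite_induct) (simp_all add: chain_lift_linear)
qed

lemma chain_lift_monom:
  "j \<le> N \<Longrightarrow> chain_lift N q S (monom 1 j) = (if j \<in> S then [:0, 1:] * below_chains q S j else 0)"
proof -
  assume "j \<le> N"
  have "chain_lift N q S (monom 1 j) =
      (\<Sum>i\<in>S \<inter> {..N}. if j = i then [:0, 1:] * below_chains q S i else 0)"
    unfolding chain_lift_def by (rule sum.cong) auto
  then show ?thesis
    using \<open>j \<le> N\<close> by (simp add: sum.delta)
qed

text \<open>Lifting \<open>Rpoly_Suc_eq_sum\<close> term by term reproduces the recurrence of
  \<open>chainR\<close>, with \<open>t^(m+1)\<close> giving the part for a selected rank. The extra
  1 at \<open>k = 0\<close> stands for the empty chain.\<close>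

lemma chainR_eq_chain_lift:
  "k \<le> m \<Longrightarrow> m \<le> N \<Longrightarrow>
     chainR q S m k = (if k = 0 then 1 else 0) + chain_lift N q S (Rpoly q m k)"
proof (induction m arbitrary: k)
  case 0
  then show ?case
    using chain_lift_monom[of 0 N q S] by (simp add: Rpoly_diag below_chains_def)
next
  case (Suc m)
  have "(\<Sum>i\<in>{k..m}. smult (real q ^ i) (chainR q S m i)) =
     (\<Sum>i\<in>{k..m}. smult (real q ^ i) (if i = 0 then 1 else 0))
     + (\<Sum>i\<in>{k..m}. smult (real q ^ i) (chain_lift N q S (Rpoly q m i)))"
    using Suc by (simp add: smult_add_right sum.distrib)
  also have "(\<Sum>i\<in>{k..m}. smult (real q ^ i) (if i = 0 then 1 else 0)) = (if k = 0 then 1 else 0)"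
  proof -
    have "(\<Sum>i\<in>{k..m}. smult (real q ^ i) (if i = 0 then 1 else 0)) =
      (\<Sum>i\<in>{k..m}. if 0 = i then 1 else (0 :: real poly))"
      by (rule sum.cong) auto
    then show ?thesis by (simp add: sum.delta)
  qed
  finally show ?case
    using Suc.prems by (simp add: Rpoly_Suc_eq_sum chain_lift_linear chain_lift_sum chain_lift_monom
        below_chains_def)
qed

text \<open>\<open>R_{j,0}\<close> counts all subspaces of a space of dimension \<open>j\<close>, so
  the difference counts the proper ones. Its degree is below \<open>j\<close>, which is why
  \<open>j = N + 1\<close> is still allowed.\<close>

lemma below_chains_eq_chain_lift:
  assumes "j \<le> Suc N"
  shows "below_chains q S j = 1 + chain_lift N q S (Rpoly q j 0 - monom 1 j)"
proof (cases j)
  case 0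
  then show ?thesis
    by (simp add: below_chains_def Rpoly_diag chain_lift_def)
next
  case (Suc m)
  have "Rpoly q j 0 - monom 1 j = (\<Sum>i\<le>m. smult (real q ^ i) (Rpoly q m i))"
    by (simp add: Suc Rpoly_Suc_eq_sum atLeast0AtMost)
  moreover have "(\<Sum>i\<le>m. smult (real q ^ i) (chainR q S m i)) =
      (\<Sum>i\<le>m. if 0 = i then 1 else 0) + (\<Sum>i\<le>m. smult (real q ^ i) (chain_lift N q S (Rpoly q m i)))"
    unfolding sum.distrib[symmetric] using assms Suc
    by (intro sum.cong) (auto simp: chainR_eq_chain_lift[of _ m N] smult_add_right)
  ultimately show ?thesis
    by (simp add: Suc below_chains_def chain_lift_sum chain_lift_linear sum.delta)
qed

text \<open>Chains are sorted by their top \<open>y\<close>. By induction the part below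
  \<open>y\<close> depends only on \<open>dim y\<close>, so the sum is a lift of the rank generating
  polynomial of the proper subspaces of \<open>x\<close>.\<close>

lemma chain_poly_below:
  fixes x :: "(nat \<Rightarrow> 'a::{field,finite}) set"
  assumes "x \<in> subspaces n"
  shows "chain_poly {y \<in> subspaces n. y < x \<and> fs.dim y \<in> S} = below_chains CARD('a) S (fs.dim x)"
  using assms
proof (induction "fs.dim x" arbitrary: x rule: less_induct)
  case (less x)
  let ?N = "fs.dim x"
  let ?Q = "\<lambda>x. {y \<in> subspaces n. y < x \<and> fs.dim y \<in> S}"
  have fin: "finite {y \<in> subspaces n. P y}" for P :: "(nat \<Rightarrow> 'a) set \<Rightarrow> bool"
    by (rule finite_subset[OF _ finite_subspaces[of n]]) auto
  have "chain_poly (?Q x) = 1 + (\<Sum>y\<in>?Q x. [:0, 1:] * chain_poly {z \<in> ?Q x. z < y})"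
    by (rule chain_poly_rec[OF fin])
  also have "(\<Sum>y\<in>?Q x. [:0, 1:] * chain_poly {z \<in> ?Q x. z < y}) =
      (\<Sum>y\<in>?Q x. [:0, 1:] * below_chains CARD('a) S (fs.dim y))"
  proof (rule sum.cong[OF refl])
    fix y assume y: "y \<in> ?Q x"
    then have "{z \<in> ?Q x. z < y} = ?Q y"
      by auto
    then show "[:0, 1:] * chain_poly {z \<in> ?Q x. z < y} = [:0, 1:] * below_chains CARD('a) S (fs.dim y)"
      using less.hyps[of y] dim_strict_mono_subspaces[of y n x] y less.prems by simp
  qed
  also have "\<dots> = (\<Sum>y | y \<in> subspaces n \<and> y < x. chain_lift ?N CARD('a) S (monom 1 (fs.dim y)))"
  proof -
    have "(\<Sum>y | y \<in> subspaces n \<and> y < x. chain_lift ?N CARD('a) S (monom 1 (fs.dim y))) =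
      (\<Sum>y | y \<in> subspaces n \<and> y < x.
         if fs.dim y \<in> S then [:0, 1:] * below_chains CARD('a) S (fs.dim y) else 0)"
      using dim_strict_mono_subspaces[OF _ less.prems]
      by (intro sum.cong refl) (simp add: chain_lift_monom order_less_imp_le)
    then show ?thesis
      using fin by (simp add: sum.inter_filter[symmetric] conj_assoc)
  qed
  also have "\<dots> = chain_lift ?N CARD('a) S (Rpoly CARD('a) ?N 0 - monom 1 ?N)"
  proof -
    have "{y. y \<in> subspaces n \<and> y \<subseteq> x} = insert x {y. y \<in> subspaces n \<and> y < x}"
      using less.prems by auto
    then have "Rpoly CARD('a) ?N 0 = monom 1 ?N + (\<Sum>y | y \<in> subspaces n \<and> y < x. monom 1 (fs.dim y))"
      using fin by (simp add: dim_poly_subspaces[OF less.prems, symmetric] dim_poly_def)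
    then show ?thesis
      by (simp add: chain_lift_sum)
  qed
  finally show ?case
    by (simp add: below_chains_eq_chain_lift[of ?N ?N])
qed

text \<open>An order ideal contains every subspace of each member \<open>x\<close>, so the chains
  below \<open>x\<close> are those of the full lattice and \<open>chain_poly_below\<close>
  applies.\<close>

lemma chain_poly_order_ideal:
  fixes P :: "(nat \<Rightarrow> 'a::{field,finite}) set set"
  assumes P: "order_ideal n P" and N: "\<And>x. x \<in> P \<Longrightarrow> fs.dim x \<le> N"
  shows "chain_poly {x \<in> P. fs.dim x \<in> S} =
    1 + chain_lift N CARD('a) S (\<Sum>x\<in>P. monom 1 (fs.dim x))"
proof -
  have sub: "P \<subseteq> subspaces n"
    using P by (simp add: order_ideal_def)
  then have fin: "finite P"
    using finite_subset finite_subspaces by blast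
  let ?Q = "{x \<in> P. fs.dim x \<in> S}"
  have "chain_poly ?Q = 1 + (\<Sum>x\<in>?Q. [:0, 1:] * chain_poly {y \<in> ?Q. y < x})"
    by (rule chain_poly_rec) (simp add: fin)
  also have "(\<Sum>x\<in>?Q. [:0, 1:] * chain_poly {y \<in> ?Q. y < x}) =
     (\<Sum>x\<in>?Q. chain_lift N CARD('a) S (monom 1 (fs.dim x)))"
  proof (rule sum.cong[OF refl])
    fix x assume x: "x \<in> ?Q"
    then have "{y \<in> ?Q. y < x} = {y \<in> subspaces n. y < x \<and> fs.dim y \<in> S}"
      using P by (auto simp: order_ideal_def)
    then show "[:0, 1:] * chain_poly {y \<in> ?Q. y < x} = chain_lift N CARD('a) S (monom 1 (fs.dim x))"
      using x sub N chain_poly_below[of x n S] by (auto simp: chain_lift_monom)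
  qed
  also have "\<dots> = (\<Sum>x\<in>P. chain_lift N CARD('a) S (monom 1 (fs.dim x)))"
    using fin N by (intro sum.mono_neutral_left) (auto simp: chain_lift_monom)
  finally show ?thesis
    by (simp add: chain_lift_sum)
qed

theorem Bq_positive_real_rooted:
  fixes P :: "(nat \<Rightarrow> 'a::{field,finite}) set set"
  assumes "Bq_positive CARD('a) n P"
  shows "real_rooted (chain_poly {x \<in> P. fs.dim x \<in> S})"
proof -
  let ?q = "CARD('a)"
  define r where "r = ideal_rank P"
  from assms obtain h where P: "order_ideal n P" "P \<noteq> {}" and h: "\<And>k. k \<le> r \<Longrightarrow> 0 \<le> h k"
    and eq: "(\<Sum>x\<in>P. monom 1 (fs.dim x)) = (\<Sum>k\<le>r. smult (h k) (Rpoly ?q r k))"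
    by (auto simp: Bq_positive_def r_def)
  have sub: "P \<subseteq> subspaces n"
    using P by (simp add: order_ideal_def)
  then have fin: "finite P"
    using finite_subset finite_subspaces by blast
  have "{0} \<in> P"
    using P zero_in_subspaces zero_subset_subspace sub by (fastforce simp: order_ideal_def)
  then have "{x \<in> P. fs.dim x = 0} = {{0}}"
    using subspace_dim_0 sub by (auto simp: dim_zero_space)
  \<comment> \<open>Comparison of constant terms: among the \<open>R_{r,k}\<close> only
    \<open>R_{r,0}\<close> has one, and only the zero space has dimension 0. This yields the
    positive weight that \<open>fan_combination\<close> needs.\<close>
  have "h 0 = (\<Sum>k\<le>r. if 0 = k then h k else 0)"
    by (simp add: sum.delta)
  also have "\<dots> = coeff (\<Sum>k\<le>r. smult (h k) (Rpoly ?q r k)) 0"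
    unfolding coeff_sum by (intro sum.cong) (auto simp: coeff_0_Rpoly)
  also have "\<dots> = (\<Sum>x\<in>P. if fs.dim x = 0 then 1 else 0)"
    unfolding eq[symmetric] by (simp add: coeff_sum)
  also have "\<dots> = 1"
    using fin \<open>{x \<in> P. fs.dim x = 0} = {{0}}\<close> by (simp add: sum.inter_filter[symmetric])
  finally have h0: "h 0 = 1" .
  have "fs.dim x \<le> r" if "x \<in> P" for x
    using fin that by (simp add: r_def ideal_rank_def)
  then have "chain_poly {x \<in> P. fs.dim x \<in> S} =
      1 + (\<Sum>k\<le>r. smult (h k) (chain_lift r ?q S (Rpoly ?q r k)))"
    using chain_poly_order_ideal[OF P(1), of r S] by (simp add: eq chain_lift_sum chain_lift_linear)
  \<comment> \<open>As \<open>h 0 = 1\<close>, the empty chain is absorbed into the extra 1 of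
    \<open>chainR\<close> at \<open>k = 0\<close>.\<close>
  also have "1 = (\<Sum>k\<le>r. if 0 = k then [:h k:] else 0)"
    using h0 by (simp add: sum.delta one_pCons)
  also have "(\<Sum>k\<le>r. if 0 = k then [:h k:] else 0) + (\<Sum>k\<le>r. smult (h k) (chain_lift r ?q S (Rpoly ?q r k)))
      = (\<Sum>k\<le>r. smult (h k) (chainR ?q S r k))"
    unfolding sum.distrib[symmetric]
    by (intro sum.cong) (auto simp: chainR_eq_chain_lift[of _ r r] smult_add_right)
  finally show ?thesis
    using real_rooted_chainR_combination[of ?q r h S] h h0 card_field_gt_1[where 'a='a] by simp
qed

theorem theorem7p14:
  fixes q n :: nat and \<phi> :: "(nat \<Rightarrow> 'a::{field,finite}) set \<Rightarrow> nat"
  assumes "CARD('a) = q"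
    and "q_matroid n \<phi>"
  shows "Bq_positive q n (indep_spaces n \<phi>) \<and>
         real_rooted (chain_poly (indep_spaces n \<phi>)) \<and>
         (\<forall>S :: nat set. real_rooted (chain_poly {x \<in> indep_spaces n \<phi>. fs.dim x \<in> S}))"
proof -
  have pos: "Bq_positive CARD('a) n (indep_spaces n \<phi>)"
    using assms(2) by (rule Bq_positive_indep_spaces)
  then show ?thesis
    using Bq_positive_real_rooted[OF pos] Bq_positive_real_rooted[OF pos, of UNIV] assms(1) by simp
qed

end
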